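(* Let $\boldsymbol{M}$ be the Polish space of all infinite minimal subshifts with some finite alphabet $\mathsf{A}\subseteq\mathbb{Z}$. The set of all strong Toeplitz subshifts $(X,S)$ of rank $2$ such that $(X,S)$ is not conjugate to $(X,S^{-1})$ is generic in $\boldsymbol{M}$.
   Context: **Subshifts.** For a finite alphabet $\mathsf{A}$, $S$ is the shift on $\mathsf{A}^{\mathbb{Z}}$, $S(x)(i)=x(i+1)$. A subshift is a closed set $X\subseteq\mathsf{A}^{\mathbb{Z}}$ with $S(X)=X$; it is minimal if every $S$-orbit is dense. Systems $(X,T)$, $(Y,T')$ are conjugate if there is a homeomorphism $\varphi\colon X\to Y$ with $\varphi\circ T=T'\circ\varphi$. **The space.** Let $\boldsymbol{S}$ be the space of all subshifts with some finite alphabet $\mathsf{A}\subseteq\mathbb{Z}$, with metric $d(X,Y)=2^{-\inf\{n\,:\,L_n(X)\neq L_n(Y)\}}$, where $L_n(X)$ is the set of words of length $n$ occurring in elements of $X$. It is Polish, and $\boldsymbol{M}\subseteq\boldsymbol{S}$, the set of infinite minimal subshifts with the subspace topology, is a $G_\delta$ subset, hence Polish. A subset of a Polish space is generic if it contains a dense $G_\delta$ subset. **Strong Toeplitz subshifts.** A morphism $\tau\colon A^*\to B^*$ between sets of finite words over finite alphabets satisfies $\tau(uv)=\tau(u)\tau(v)$; all morphisms are non-erasing ($\tau(a)$ is nonempty for all $a\in A$). For $y\in A^{\mathbb{Z}}$, $\tau(y)=\cdots\tau(y(-1)).\tau(y(0))\tau(y(1))\cdots$, where the dot marks that position $0$ is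 the start of $\tau(y(0))$. A directive sequence is a sequence of morphisms $\boldsymbol{\tau}=(\tau_n\colon A_{n+1}^*\to A_n^* )_{n\geq0}$; put $\tau_{[n,N)}=\tau_n\circ\cdots\circ\tau_{N-1}$. $X^{(n)}_{\boldsymbol{\tau}}$ is the set of $x\in A_n^{\mathbb{Z}}$ such that every finite subword of $x$ occurs in $\tau_{[n,N)}(a)$ for some $N>n$, $a\in A_N$; $X_{\boldsymbol{\tau}}=X^{(0)}_{\boldsymbol{\tau}}$ is the $\mathcal{S}$-adic subshift generated by $\boldsymbol{\tau}$. The alphabet rank of $\boldsymbol{\tau}$ is $\liminf_n|A_n|$. $\boldsymbol{\tau}$ is: constant-length if for each $n$, $|\tau_n(a)|$ does not depend on $a\in A_{n+1}$; primitive if for every $n$ there is $N>n$ such that all letters of $A_n$ occur in $\tau_{[n,N)}(a)$ for all $a\in A_N$; proper if for each $n$ all words $\tau_n(a)$, $a\in A_{n+1}$, start with the same letter and end with the same letter; recognizable if for each $n$ every $x\in A_n^{\mathbb{Z}}$ admits at most one pair $(y,k)$ with $y\in X^{(n+1)}_{\boldsymbol{\tau}}$, $0\leq k<|\tau_n(y(0))|$ and $x=S^k\tau_n(y)$. For $K\geq2$, a strong Toeplitz subshift of rank $K$ is a subshift conjugate to an $\mathcal{S}$-adic subshift generated by a constant-length, primitive, proper and recognizable directive sequence of alphabet rank $k\leq K$. *)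

theory Defs
  imports "HOL-Analysis.Analysis" "HOL-Library.Sublist" "HOL-Library.Extended_Nat"
begin

section \<open>Subshifts\<close>

text \<open>Letters are integers.  \<^typ>\<open>int\<close> carries the discrete topology and
  \<^typ>\<open>int \<Rightarrow> int\<close> the product topology; since the full shift over a finite alphabet is
  closed there, being closed in the full shift is the same as being closed in
  \<^typ>\<open>int \<Rightarrow> int\<close>.\<close>

definition shift :: "(int \<Rightarrow> int) \<Rightarrow> (int \<Rightarrow> int)" where
  "shift x = (\<lambda>i. x (i + 1))"

definition full_shift :: "int set \<Rightarrow> (int \<Rightarrow> int) set" where
  "full_shift A = {x. \<forall>i. x i \<in> A}"

definition subshift :: "(int \<Rightarrow> int) set \<Rightarrow> bool" where
  "subshift X \<longleftrightarrow> (\<exists>A. finite A \<and> X \<subseteq> full_shift A) \<and> closed X \<and> shift ` X = X"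

definition orbit :: "(int \<Rightarrow> int) \<Rightarrow> (int \<Rightarrow> int) set" where
  "orbit x = range (\<lambda>k i. x (i + k))"

definition minimal :: "(int \<Rightarrow> int) set \<Rightarrow> bool" where
  "minimal X \<longleftrightarrow> (\<forall>x\<in>X. X \<subseteq> closure (orbit x))"

definition conjugate ::
  "'a::topological_space set \<Rightarrow> ('a \<Rightarrow> 'a) \<Rightarrow> 'b::topological_space set \<Rightarrow> ('b \<Rightarrow> 'b) \<Rightarrow> bool" where
  "conjugate X T Y T' \<longleftrightarrow>
     (\<exists>\<phi> \<psi>. homeomorphism X Y \<phi> \<psi> \<and> (\<forall>x\<in>X. \<phi> (T x) = T' (\<phi> x)))"

lemma inv_shift: "inv shift = (\<lambda>x i. x (i - 1))"
  by (rule inv_equality) (auto simp: shift_def)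

lemma bij_shift: "bij shift"
  by (rule o_bij[where g = "\<lambda>x i. x (i - 1)"]) (auto simp: shift_def fun_eq_iff)


section \<open>The space of subshifts\<close>

definition word :: "(int \<Rightarrow> int) \<Rightarrow> int \<Rightarrow> nat \<Rightarrow> int list" where
  "word x i n = map (\<lambda>k. x (i + int k)) [0..<n]"

definition lang :: "nat \<Rightarrow> (int \<Rightarrow> int) set \<Rightarrow> int list set" where
  "lang n X = {word x i n | x i. x \<in> X}"

text \<open>The first case is the convention \<open>2 powr (- \<infinity>) = 0\<close> for an infimum over the
  empty set.\<close>

definition subshift_dist :: "(int \<Rightarrow> int) set \<Rightarrow> (int \<Rightarrow> int) set \<Rightarrow> real" where
  "subshift_dist X Y =
     (if \<forall>n. lang n X = lang n Y then 0 else 1 / 2 ^ (Inf {n. lang n X \<noteq> lang n Y}))"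

definition subshift_topology :: "(int \<Rightarrow> int) set topology" where
  "subshift_topology = Metric_space.mtopology {X. subshift X} subshift_dist"

definition infinite_minimal_subshifts :: "(int \<Rightarrow> int) set set" where
  "infinite_minimal_subshifts = {X. subshift X \<and> minimal X \<and> infinite X}"

definition infinite_minimal_topology :: "(int \<Rightarrow> int) set topology" where
  "infinite_minimal_topology = subtopology subshift_topology infinite_minimal_subshifts"

definition generic_in :: "'a topology \<Rightarrow> 'a set \<Rightarrow> bool" where
  "generic_in T U \<longleftrightarrow>
     U \<subseteq> topspace T \<and> (\<exists>G. gdelta_in T G \<and> T closure_of G = topspace T \<and> G \<subseteq> U)"

lemma word_append: "word x i (m + n) = word x i m @ word x (i + int m) n"
  by (rule nth_equalityI) (auto simp: word_def nth_append algebra_simps)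

lemma subshift_shift_nat: 
  assumes "shift ` X = X" "x \<in> X"
  shows "(\<lambda>i. x (i + int n)) \<in> X \<and> (\<lambda>i. x (i - int n)) \<in> X"
proof (induction n)
  case 0
  then show ?case using assms by simp
next
  case (Suc n)
  have 1: "shift y \<in> X" if "y \<in> X" for y
    using imageI[OF that, of shift] unfolding assms(1) .
  have 2: "(\<lambda>i. y (i - 1)) \<in> X" if "y \<in> X" for y
  proof -
    have "y \<in> shift ` X" unfolding assms(1) by (fact that)
    then obtain z where "z \<in> X" "y = shift z" by blast
    then show ?thesis by (simp add: shift_def)
  qed
  show ?case
    using 1[of "\<lambda>i. x (i + int n)"] 2[of "\<lambda>i. x (i - int n)"] Suc
    by (simp add: shift_def algebra_simps)
qed

lemma subshift_shift_int:
  assumes "shift ` X = X" "x \<in> X"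
  shows "(\<lambda>i. x (i + k)) \<in> X"
  using subshift_shift_nat[OF assms, of "nat \<bar>k\<bar>"] by (cases "k \<ge> 0") auto

lemma lang_subset_imp_subset:
  assumes X: "subshift X" and Y: "subshift Y" and L: "\<And>n. lang n X \<subseteq> lang n Y"
  shows "X \<subseteq> Y"
proof
  fix x assume x: "x \<in> X"
  have "\<exists>y\<in>Y. \<forall>i. \<bar>i\<bar> \<le> int n \<longrightarrow> y i = x i" for n
  proof -
    have "word x (- int n) (2*n+1) \<in> lang (2*n+1) Y"
      using L x unfolding lang_def by blast
    then obtain z j where z: "z \<in> Y" "word x (- int n) (2*n+1) = word z j (2*n+1)"
      unfolding lang_def by blast
    let ?y = "\<lambda>i. z (i + (j + int n))"
    have "?y \<in> Y" using Y z(1) by (simp add: subshift_def subshift_shift_int)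
    moreover have "?y i = x i" if "\<bar>i\<bar> \<le> int n" for i
    proof -
      have "nat (i + int n) < 2*n+1" using that by linarith
      then have "word x (- int n) (2*n+1) ! nat (i + int n) = x i"
        "word z j (2*n+1) ! nat (i + int n) = ?y i"
        using that by (auto simp: word_def algebra_simps simp del: upt_Suc)
      then show ?thesis using z(2) by simp
    qed
    ultimately show ?thesis by (intro bexI[of _ ?y] allI impI)
  qed
  then obtain y where y: "\<And>n. y n \<in> Y" "\<And>n i. \<bar>i\<bar> \<le> int n \<Longrightarrow> y n i = x i"
    by metis
  have "(\<lambda>n. y n i) \<longlonglongrightarrow> x i" for i
    by (rule tendsto_eventually)
       (rule eventually_sequentiallyI[of "nat \<bar>i\<bar>"], rule y, auto)
  then have "limitin (product_topology (\<lambda>i. euclidean) UNIV) y x sequentially"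
    by (subst limitin_componentwise) auto
  then have "y \<longlonglongrightarrow> x"
    by (simp add: euclidean_product_topology)
  then show "x \<in> Y"
    using Lim_in_closed_set[of Y y sequentially x] Y y(1) by (simp add: subshift_def)
qed

lemma subshift_dist_nonneg: "0 \<le> subshift_dist X Y"
  by (simp add: subshift_dist_def)

lemma subshift_dist_ultra:
  "subshift_dist X Z \<le> max (subshift_dist X Y) (subshift_dist Y Z)"
proof (cases "\<forall>n. lang n X = lang n Z")
  case True
  then show ?thesis by (auto simp: subshift_dist_def le_max_iff_disj)
next
  case False
  define m where "m = Inf {n. lang n X \<noteq> lang n Z}"
  have m: "lang m X \<noteq> lang m Z"
    using Inf_nat_def1[of "{n. lang n X \<noteq> lang n Z}"] False by (auto simp: m_def)
  have dXZ: "subshift_dist X Z = 1 / 2 ^ m"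
    using False by (auto simp: subshift_dist_def m_def)
  have *: "1 / 2 ^ m \<le> subshift_dist U V" if "lang m U \<noteq> lang m V" for U V
  proof -
    have "Inf {n. lang n U \<noteq> lang n V} \<le> m" using that by (intro wellorder_Inf_le1) auto
    then have "1 / (2::real) ^ m \<le> 1 / 2 ^ Inf {n. lang n U \<noteq> lang n V}"
      by (simp add: field_simps)
    then show ?thesis using that unfolding subshift_dist_def by presburger
  qed
  show ?thesis using m *[of X Y] *[of Y Z] unfolding dXZ le_max_iff_disj by metis
qed

lemma Metric_space_subshifts: "Metric_space {X. subshift X} subshift_dist"
proof
  show "0 \<le> subshift_dist X Y" for X Y by (rule subshift_dist_nonneg)
  show c: "subshift_dist X Y = subshift_dist Y X" for X Y
  proof -
    have "{n. lang n X \<noteq> lang n Y} = {n. lang n Y \<noteq> lang n X}"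
      "(\<forall>n. lang n X = lang n Y) \<longleftrightarrow> (\<forall>n. lang n Y = lang n X)"
      by metis+
    then show ?thesis by (simp only: subshift_dist_def)
  qed
  show "subshift_dist X Y = 0 \<longleftrightarrow> X = Y"
    if "X \<in> {X. subshift X}" "Y \<in> {X. subshift X}" for X Y
    using lang_subset_imp_subset[of X Y] lang_subset_imp_subset[of Y X] that
    by (auto simp: subshift_dist_def split: if_splits)
  show "subshift_dist X Z \<le> subshift_dist X Y + subshift_dist Y Z" for X Y Z
    using subshift_dist_ultra[of X Z Y]
    using subshift_dist_nonneg[of X Y] subshift_dist_nonneg[of Y Z] by linarith
qed

lemma topspace_infinite_minimal_topology:
  "topspace infinite_minimal_topology = infinite_minimal_subshifts"
  using Metric_space.topspace_mtopology[OF Metric_space_subshifts]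
  by (auto simp: infinite_minimal_topology_def subshift_topology_def
      infinite_minimal_subshifts_def)


section \<open>Morphisms\<close>

text \<open>Non-erasing morphisms from \<^term>\<open>lists A\<close> to \<^term>\<open>lists B\<close>; values outside
  \<^term>\<open>lists A\<close> are irrelevant.\<close>

definition morphism :: "int set \<Rightarrow> int set \<Rightarrow> (int list \<Rightarrow> int list) \<Rightarrow> bool" where
  "morphism A B \<tau> \<longleftrightarrow>
     (\<forall>w\<in>lists A. \<tau> w \<in> lists B) \<and>
     (\<forall>u\<in>lists A. \<forall>v\<in>lists A. \<tau> (u @ v) = \<tau> u @ \<tau> v) \<and>
     (\<forall>a\<in>A. \<tau> [a] \<noteq> [])"

text \<open>The two-sided infinite word \<open>\<dots> \<tau>(y(-1)) . \<tau>(y(0)) \<tau>(y(1)) \<dots>\<close>.  As \<open>\<tau>\<close> is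
  non-erasing, for \<open>0 \<le> i\<close> position \<open>i\<close> lies within \<open>\<tau>(y(0) \<dots> y(i))\<close>, and for
  \<open>i < 0\<close> it lies within \<open>\<tau>(y(i) \<dots> y(-1))\<close>, which ends at position \<open>-1\<close>.\<close>

definition extend :: "(int list \<Rightarrow> int list) \<Rightarrow> (int \<Rightarrow> int) \<Rightarrow> (int \<Rightarrow> int)" where
  "extend \<tau> y = (\<lambda>i.
     if 0 \<le> i then \<tau> (word y 0 (nat i + 1)) ! nat i
     else let w = \<tau> (word y i (nat (- i))) in w ! nat (int (length w) + i))"

lemma word_in_lists: "y \<in> full_shift A \<Longrightarrow> word y i n \<in> lists A"
  by (auto simp: word_def full_shift_def)

lemma length_word [simp]: "length (word y i n) = n"
  by (simp add: word_def)

lemma nth_word [simp]: "k < n \<Longrightarrow> word y i n ! k = y (i + int k)"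
  by (simp add: word_def)

lemma length_morphism:
  assumes "morphism A B \<tau>" "w \<in> lists A"
  shows "length w \<le> length (\<tau> w)"
  using assms(2)
proof (induction w)
  case (Cons a w)
  have "\<tau> ([a] @ w) = \<tau> [a] @ \<tau> w" "\<tau> [a] \<noteq> []"
    using assms(1) Cons by (auto simp: morphism_def simp del: append_Cons)
  then show ?case using Cons by (cases "\<tau> [a]") auto
qed auto

lemma extend_right:
  assumes m: "morphism A B \<tau>" and y: "y \<in> full_shift A"
  shows "word (extend \<tau> y) 0 (length (\<tau> (word y 0 n))) = \<tau> (word y 0 n)"
proof (rule nth_equalityI)
  fix k assume "k < length (word (extend \<tau> y) 0 (length (\<tau> (word y 0 n))))"
  then have k: "k < length (\<tau> (word y 0 n))" by simp
  have app: "\<tau> (word y 0 (p + q)) = \<tau> (word y 0 p) @ \<tau> (word y (int p) q)" for p q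
    using m word_in_lists[OF y] by (simp add: morphism_def word_append)
  have k': "k < length (\<tau> (word y 0 (k + 1)))"
    using length_morphism[OF m word_in_lists[OF y], of 0 "k + 1"] by simp
  have "\<tau> (word y 0 (k + 1)) ! k = \<tau> (word y 0 n) ! k"
  proof (cases "k + 1 \<le> n")
    case True
    then show ?thesis using app[of "k + 1" "n - (k + 1)"] k' by (simp add: nth_append)
  next
    case False
    then show ?thesis using app[of n "k + 1 - n"] k by (simp add: nth_append)
  qed
  then show "word (extend \<tau> y) 0 (length (\<tau> (word y 0 n))) ! k = \<tau> (word y 0 n) ! k"
    using k by (simp add: extend_def)
qed simp

lemma extend_left:
  fixes n :: nat
  assumes m: "morphism A B \<tau>" and y: "y \<in> full_shift A"
  defines "w \<equiv> \<tau> (word y (- int n) n)"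
  shows "word (extend \<tau> y) (- int (length w)) (length w) = w"
proof (rule nth_equalityI)
  fix k assume "k < length (word (extend \<tau> y) (- int (length w)) (length w))"
  then have k: "k < length w" by simp
  define j where "j = length w - k"
  have j: "j > 0" "j \<le> length w" "k = length w - j" using k by (auto simp: j_def)
  define v where "v = \<tau> (word y (- int j) j)"
  have app: "\<tau> (word y (- int (p + q)) (p + q)) = \<tau> (word y (- int (p + q)) p) @ \<tau> (word y (- int q) q)" for p q
    using m word_in_lists[OF y] word_append[of y "- int (p+q)" p q] by (simp add: morphism_def)
  have v: "j \<le> length v"
    using length_morphism[OF m word_in_lists[OF y], of "- int j" j] by (simp add: v_def)
  have "v ! (length v - j) = w ! (length w - j)"
  proof (cases "j \<le> n")
    case True
    then obtain u where "w = u @ v" using app[of "n - j" j] by (auto simp: w_def v_def)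
    then show ?thesis using nth_append_length_plus[of u v "length v - j"] v by simp
  next
    case False
    then obtain u where "v = u @ w" using app[of "j - n" n] by (auto simp: w_def v_def)
    then show ?thesis using nth_append_length_plus[of u w "length w - j"] j by simp
  qed
  moreover have "extend \<tau> y (- int j) = v ! (length v - j)"
    using j(1) v by (simp add: extend_def v_def Let_def nat_diff_distrib flip: of_nat_diff)
  ultimately show "word (extend \<tau> y) (- int (length w)) (length w) ! k = w ! k"
    using k j by (simp add: of_nat_diff)
qed simp


section \<open>Strong Toeplitz subshifts\<close>

text \<open>In the following, \<open>\<A> n\<close> is the \<open>n\<close>-th alphabet and \<open>\<tau> n\<close> maps words over
  \<open>\<A> (n + 1)\<close> to words over \<open>\<A> n\<close>.\<close>

definition directive_sequence ::
  "(nat \<Rightarrow> int set) \<Rightarrow> (nat \<Rightarrow> int list \<Rightarrow> int list) \<Rightarrow> bool" where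
  "directive_sequence \<A> \<tau> \<longleftrightarrow> (\<forall>n. finite (\<A> n) \<and> morphism (\<A> (Suc n)) (\<A> n) (\<tau> n))"

text \<open>\<open>\<tau> n \<circ> \<dots> \<circ> \<tau> (N - 1)\<close>\<close>

definition tau_comp :: "(nat \<Rightarrow> int list \<Rightarrow> int list) \<Rightarrow> nat \<Rightarrow> nat \<Rightarrow> int list \<Rightarrow> int list" where
  "tau_comp \<tau> n N = foldr (\<circ>) (map \<tau> [n..<N]) id"

definition S_adic_level ::
  "(nat \<Rightarrow> int set) \<Rightarrow> (nat \<Rightarrow> int list \<Rightarrow> int list) \<Rightarrow> nat \<Rightarrow> (int \<Rightarrow> int) set" where
  "S_adic_level \<A> \<tau> n =
     {x \<in> full_shift (\<A> n). \<forall>i m. \<exists>N>n. \<exists>a\<in>\<A> N. sublist (word x i m) (tau_comp \<tau> n N [a])}"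

abbreviation S_adic :: "(nat \<Rightarrow> int set) \<Rightarrow> (nat \<Rightarrow> int list \<Rightarrow> int list) \<Rightarrow> (int \<Rightarrow> int) set" where
  "S_adic \<A> \<tau> \<equiv> S_adic_level \<A> \<tau> 0"

definition alphabet_rank :: "(nat \<Rightarrow> int set) \<Rightarrow> enat" where
  "alphabet_rank \<A> = liminf (\<lambda>n. enat (card (\<A> n)))"

definition constant_length :: "(nat \<Rightarrow> int set) \<Rightarrow> (nat \<Rightarrow> int list \<Rightarrow> int list) \<Rightarrow> bool" where
  "constant_length \<A> \<tau> \<longleftrightarrow>
     (\<forall>n. \<forall>a\<in>\<A> (Suc n). \<forall>b\<in>\<A> (Suc n). length (\<tau> n [a]) = length (\<tau> n [b]))"

definition primitive :: "(nat \<Rightarrow> int set) \<Rightarrow> (nat \<Rightarrow> int list \<Rightarrow> int list) \<Rightarrow> bool" where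
  "primitive \<A> \<tau> \<longleftrightarrow> (\<forall>n. \<exists>N>n. \<forall>a\<in>\<A> N. \<A> n \<subseteq> set (tau_comp \<tau> n N [a]))"

definition proper :: "(nat \<Rightarrow> int set) \<Rightarrow> (nat \<Rightarrow> int list \<Rightarrow> int list) \<Rightarrow> bool" where
  "proper \<A> \<tau> \<longleftrightarrow>
     (\<forall>n. \<forall>a\<in>\<A> (Suc n). \<forall>b\<in>\<A> (Suc n).
        hd (\<tau> n [a]) = hd (\<tau> n [b]) \<and> last (\<tau> n [a]) = last (\<tau> n [b]))"

definition recognizable :: "(nat \<Rightarrow> int set) \<Rightarrow> (nat \<Rightarrow> int list \<Rightarrow> int list) \<Rightarrow> bool" where
  "recognizable \<A> \<tau> \<longleftrightarrow>
     (\<forall>n. \<forall>x\<in>full_shift (\<A> n).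
        \<exists>\<^sub>\<le>\<^sub>1 (y, k). y \<in> S_adic_level \<A> \<tau> (Suc n) \<and> k < length (\<tau> n [y 0]) \<and>
                   x = (shift ^^ k) (extend (\<tau> n) y))"

definition strong_Toeplitz :: "nat \<Rightarrow> (int \<Rightarrow> int) set \<Rightarrow> bool" where
  "strong_Toeplitz K X \<longleftrightarrow>
     subshift X \<and>
     (\<exists>\<A> \<tau>. directive_sequence \<A> \<tau> \<and> constant_length \<A> \<tau> \<and> primitive \<A> \<tau> \<and>
        proper \<A> \<tau> \<and> recognizable \<A> \<tau> \<and> alphabet_rank \<A> \<le> enat K \<and>
        conjugate X shift (S_adic \<A> \<tau>) shift)"

end

theory Submission
  imports Defs
begin

text \<open>A pair of distinct words \<open>x\<close>, \<open>y\<close> of a common length \<open>q\<close> is combined, following a fixed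
  substitution of length 20, into two long words
  \<open>x\<^sup>4 y x\<^sup>7 y xyxy xyy\<close> and \<open>x\<^sup>4 y x\<^sup>7 y xyxy yxy\<close>; let \<open>coded (x, y)\<close> be the
  subshift of all bi-infinite concatenations of these two words.  Three features of the
  pattern carry the proof.

  \<^item> The run \<open>x\<^sup>7\<close> is the only long stretch with period \<open>q\<close>, so that the common beginning
    \<open>x\<^sup>4 y x\<^sup>7 y\<close> of the long words occurs only where a long word starts
    (\<open>head_at_cut\<close>).  Hence the parsing is unique, which is recognizability, and being
    contained in \<open>coded (x, y)\<close> can be read off the words of length \<open>40 q\<close>
    (\<open>coded_local\<close>): it is a condition that is both closed and open.
  \<^item> All four concatenations of two of \<open>x\<close>, \<open>y\<close> occur in each long word, so that all points of
    \<open>coded (x, y)\<close> have the same words of length up to \<open>q\<close> (\<open>words_coded\<close>).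
  \<^item> The pattern is asymmetric: the run \<open>x\<^sup>4\<close> precedes \<open>x\<^sup>7\<close> at a distance at which
    no repetition follows \<open>x\<^sup>7\<close>.  A reversing block code of radius at most \<open>q / 2\<close> preserves
    stretches of period \<open>q\<close> up to a loss of \<open>q\<close>, and would exchange the two situations
    (\<open>no_local_reversal\<close>).

  A pair refines another one if its two words are concatenations of the long words of the
  other.  Along an infinite chain of refinements the subshifts \<open>coded (P k)\<close> decrease to a
  single infinite minimal subshift.  It is the \<open>\<S>\<close>-adic subshift of the substitutions of the
  chain, all of which have constant length and start and end with the same letters, on
  two-letter alphabets from level 1 on; so it is strong Toeplitz of rank 2
  (\<open>strong_Toeplitz_chain_limit\<close>).  Continuous reversals are block codes of some radius, which
  is exceeded by the lengths in the chain; so it is not conjugate to its inverse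
  (\<open>not_conjugate_inverse\<close>).

  Refinements approximate everything: if \<open>\<alpha>\<close>, \<open>\<beta>\<close> are two consecutive long return words in
  a point of an infinite minimal subshift \<open>Y\<close>, then concatenations of \<open>\<alpha>\<beta>\<close> and \<open>\<beta>\<alpha>\<close>
  have the same short words as \<open>Y\<close>; as \<open>Y\<close> is aperiodic, \<open>\<alpha>\<close> and \<open>\<beta>\<close> can be taken such that
  \<open>\<alpha>\<beta> \<noteq> \<beta>\<alpha>\<close>, and these are two distinct words of the same length
  (\<open>approximating_pair\<close>).  If \<open>Y\<close> is coded by a pair, the return words can be cut along
  its long words, and the new pair is a refinement.

  A subshift may be coded by many pairs with incompatible parsings, so that being coded by
  arbitrarily long pairs need not give a chain.  The construction therefore selects, at each
  stage, the first pair in a fixed enumeration that refines the previously selected one and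
  codes \<open>Y\<close>.  The selection of the first \<open>k\<close> pairs depends on finitely many word lengths only, so
  the subshifts for which it succeeds form an open set, and the intersection of these sets is
  dense by a fusion argument (\<open>all_stages_dense\<close>).\<close>

section \<open>The topology in terms of languages\<close>

lemma lang_eq_mono:
  assumes "lang n X = lang n Y" "m \<le> n"
  shows "lang m X = lang m Y"
proof -
  have "lang m Z = take m ` lang n Z" for Z
  proof -
    have "word x i m = take m (word x i n)" for x i
      using word_append[of x i m "n - m"] assms(2) by simp
    then show ?thesis unfolding lang_def by (auto simp: image_iff; metis)
  qed
  then show ?thesis using assms(1) by metis
qed

lemma subshift_dist_less:
  assumes "subshift_dist X Y < 1 / 2 ^ n"
  shows "lang n X = lang n Y"
proof (rule ccontr)
  assume ne: "lang n X \<noteq> lang n Y"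
  then have "Inf {n. lang n X \<noteq> lang n Y} \<le> n" by (intro wellorder_Inf_le1) auto
  then have "1 / (2::real) ^ n \<le> 1 / 2 ^ Inf {n. lang n X \<noteq> lang n Y}"
    by (simp add: field_simps)
  then show False using assms ne unfolding subshift_dist_def by (auto split: if_splits)
qed

lemma subshift_dist_le:
  assumes "lang n X = lang n Y"
  shows "subshift_dist X Y \<le> 1 / 2 ^ n"
proof (cases "\<forall>n. lang n X = lang n Y")
  case False
  define m where "m = Inf {n. lang n X \<noteq> lang n Y}"
  have "lang m X \<noteq> lang m Y"
    using Inf_nat_def1[of "{n. lang n X \<noteq> lang n Y}"] False by (auto simp: m_def)
  then have "n < m" using lang_eq_mono[OF assms, of m] by (meson not_le)
  then have "1 / (2::real) ^ m \<le> 1 / 2 ^ n" by (simp add: field_simps)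
  then show ?thesis using False by (simp add: subshift_dist_def m_def)
qed (simp add: subshift_dist_def)

text \<open>The sets of subshifts with given words of length \<open>n\<close> form a base: they are balls.\<close>
lemma openin_infinite_minimalI:
  assumes sub: "G \<subseteq> infinite_minimal_subshifts"
    and loc: "\<And>Y. Y \<in> G \<Longrightarrow> \<exists>n. \<forall>Y'\<in>infinite_minimal_subshifts. lang n Y' = lang n Y \<longrightarrow> Y' \<in> G"
  shows "openin infinite_minimal_topology G"
proof -
  interpret Metric_space "{X. subshift X}" subshift_dist by (rule Metric_space_subshifts)
  obtain n where n: "\<And>Y Y'. Y \<in> G \<Longrightarrow> Y' \<in> infinite_minimal_subshifts \<Longrightarrow>
      lang (n Y) Y' = lang (n Y) Y \<Longrightarrow> Y' \<in> G"
    using loc by metis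
  define T where "T = {Z. subshift Z \<and> (\<exists>Y\<in>G. lang (n Y) Z = lang (n Y) Y)}"
  have "openin mtopology T"
    unfolding openin_mtopology
  proof (intro conjI allI impI)
    fix Z assume "Z \<in> T"
    then obtain Y where Y: "Y \<in> G" "lang (n Y) Z = lang (n Y) Y" by (auto simp: T_def)
    have "mball Z (1 / 2 ^ n Y) \<subseteq> T"
    proof
      fix Z' assume "Z' \<in> mball Z (1 / 2 ^ n Y)"
      then have "subshift Z'" "subshift_dist Z Z' < 1 / 2 ^ n Y" by (auto simp: in_mball)
      then show "Z' \<in> T" using Y subshift_dist_less[of Z Z' "n Y"] by (auto simp: T_def)
    qed
    then show "\<exists>r>0. mball Z r \<subseteq> T" by (intro exI[of _ "1 / 2 ^ n Y"]) auto
  qed (auto simp: T_def)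
  moreover have "G = T \<inter> infinite_minimal_subshifts"
    using n sub by (auto simp: T_def infinite_minimal_subshifts_def)
  ultimately show ?thesis
    unfolding infinite_minimal_topology_def openin_subtopology subshift_topology_def by blast
qed

lemma closure_of_infinite_minimalI:
  assumes Y: "Y \<in> infinite_minimal_subshifts"
    and G: "G \<subseteq> infinite_minimal_subshifts"
    and approx: "\<And>n. \<exists>Z\<in>G. lang n Z = lang n Y"
  shows "Y \<in> infinite_minimal_topology closure_of G"
  unfolding in_closure_of topspace_infinite_minimal_topology
proof (intro conjI allI impI)
  interpret Metric_space "{X. subshift X}" subshift_dist by (rule Metric_space_subshifts)
  fix T assume "Y \<in> T \<and> openin infinite_minimal_topology T"
  then obtain U where U: "openin mtopology U" "T = U \<inter> infinite_minimal_subshifts" "Y \<in> U"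
    unfolding infinite_minimal_topology_def openin_subtopology subshift_topology_def by blast
  then obtain r where r: "r > 0" "mball Y r \<subseteq> U" unfolding openin_mtopology by blast
  obtain n where n: "1 / 2 ^ n < r"
    using real_arch_pow_inv[OF r(1), of "1/2"] by (auto simp: power_one_over)
  obtain Z where Z: "Z \<in> G" "lang n Z = lang n Y" using approx by blast
  have "subshift_dist Y Z < r" using subshift_dist_le[of n Y Z] Z(2) n by simp
  moreover have "subshift Y" "subshift Z"
    using Y Z(1) G by (auto simp: infinite_minimal_subshifts_def)
  ultimately have "Z \<in> mball Y r" by (simp add: in_mball)
  then show "\<exists>Z. Z \<in> G \<and> Z \<in> T" using r U Z G by blast
qed (use Y in auto)

section \<open>Compactness and recurrence\<close>

text \<open>This makes \<^typ>\<open>int \<Rightarrow> int\<close> first countable, so that compactness and closures can be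
  handled by sequences.\<close>

instance int :: second_countable_topology
proof
  \<comment> \<open>the rays generate the order topology\<close>
  show "\<exists>B::int set set. countable B \<and> open = generate_topology B"
    by (intro exI[of _ "range lessThan \<union> range greaterThan"]) (auto simp: open_generated_order)
qed

lemma compact_full_shift: "finite A \<Longrightarrow> compact (full_shift A)"
proof -
  assume A: "finite A"
  have "compactin (product_topology (\<lambda>_::int. euclidean) UNIV) (PiE UNIV (\<lambda>_. A))"
    by (subst compactin_PiE) (auto intro: finite_imp_compact A)
  moreover have "PiE UNIV (\<lambda>_. A) = full_shift A"
    by (auto simp: full_shift_def PiE_def)
  ultimately show ?thesis by (simp add: euclidean_product_topology)
qed

lemma compact_subshift: "subshift X \<Longrightarrow> compact X"
  unfolding subshift_def
  by (metis compact_full_shift compact_Int_closed inf.absorb_iff2 inf_commute)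

lemma tendsto_fun_int_iff:
  fixes X :: "nat \<Rightarrow> int \<Rightarrow> int"
  shows "X \<longlonglongrightarrow> x \<longleftrightarrow> (\<forall>i. \<forall>\<^sub>F n in sequentially. X n i = x i)"
proof -
  have "X \<longlonglongrightarrow> x \<longleftrightarrow> limitin (product_topology (\<lambda>i. euclidean) UNIV) X x sequentially"
    by (simp add: euclidean_product_topology)
  also have "\<dots> \<longleftrightarrow> (\<forall>i. (\<lambda>n. X n i) \<longlonglongrightarrow> x i)"
    by (subst limitin_componentwise) auto
  also have "\<dots> \<longleftrightarrow> (\<forall>i. \<forall>\<^sub>F n in sequentially. X n i = x i)"
    by (simp add: tendsto_discrete)
  finally show ?thesis .
qed

lemma word_eq_iff: "word x i n = word y j n \<longleftrightarrow> (\<forall>k<n. x (i + int k) = y (j + int k))"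
  by (auto simp: list_eq_iff_nth_eq)

lemma word_translate: "word (\<lambda>i. x (i + k)) i n = word x (i + k) n"
  by (simp add: word_eq_iff algebra_simps)

lemma closure_agree:
  fixes x :: "int \<Rightarrow> int"
  assumes "x \<in> closure S"
  shows "\<exists>y\<in>S. word y i n = word x i n"
proof -
  obtain f where f: "\<And>k. f k \<in> S" "f \<longlonglongrightarrow> x" using assms by (auto simp: closure_sequential)
  have "\<forall>\<^sub>F k in sequentially. \<forall>j<n. f k (i + int j) = x (i + int j)"
    using f(2) unfolding tendsto_fun_int_iff
    by (subst eventually_ball_finite_distrib[of "{..<n}", unfolded Ball_def lessThan_iff]) auto
  then obtain k where "\<forall>j<n. f k (i + int j) = x (i + int j)"
    by (auto simp: eventually_sequentially)
  then show ?thesis using f(1) by (auto simp: word_eq_iff)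
qed

lemma finite_lang: "subshift X \<Longrightarrow> finite (lang n X)"
proof -
  assume "subshift X"
  then obtain A where A: "finite A" "X \<subseteq> full_shift A" by (auto simp: subshift_def)
  have "lang n X \<subseteq> {w. set w \<subseteq> A \<and> length w = n}"
    using A(2) by (fastforce simp: lang_def word_def full_shift_def)
  then show ?thesis using finite_lists_length_eq[OF A(1)] finite_subset by blast
qed

text \<open>A limit of forward shifts of \<open>y\<close> has a dense orbit, hence sees every word, and
  whatever it sees occurs far to the right in \<open>y\<close>.\<close>

lemma minimal_recurrence:
  assumes X: "subshift X" "minimal X" and y: "y \<in> X" and w: "w \<in> lang n X"
  shows "\<exists>i\<ge>i0. word y i n = w"
proof -
  have "seq_compact X" using compact_subshift[OF X(1)] by (rule compact_imp_seq_compact)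
  moreover have "\<forall>k. (\<lambda>i. y (i + int k)) \<in> X"
    using X(1) y by (auto simp: subshift_def subshift_shift_int)
  ultimately obtain l r where l: "l \<in> X" "strict_mono (r::nat\<Rightarrow>nat)"
    "((\<lambda>k i. y (i + int k)) \<circ> r) \<longlonglongrightarrow> l"
    unfolding seq_compact_def by (metis (no_types, lifting))
  obtain x j where x: "x \<in> X" "w = word x j n" using w by (auto simp: lang_def)
  have "x \<in> closure (orbit l)" using X(2) l(1) x(1) by (auto simp: minimal_def)
  then obtain z where "z \<in> orbit l" "word z j n = word x j n"
    using closure_agree[of x "orbit l" j n] by blast
  then obtain t where t: "word l (j + t) n = w"
    unfolding orbit_def using x(2) by (auto simp: word_translate)
  have ev: "\<forall>\<^sub>F k in sequentially. \<forall>m<n. y (j + t + int m + int (r k)) = l (j + t + int m)"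
    using l(3) unfolding tendsto_fun_int_iff
    by (subst eventually_ball_finite_distrib[of "{..<n}", unfolded Ball_def lessThan_iff])
      auto
  moreover have "\<forall>\<^sub>F k in sequentially. int (r k) \<ge> i0 - j - t"
  proof (rule eventually_sequentiallyI[of "nat (i0 - j - t)"])
    fix k assume "nat (i0 - j - t) \<le> k"
    then show "int (r k) \<ge> i0 - j - t" using seq_suble[OF l(2), of k] by linarith
  qed
  ultimately have "\<forall>\<^sub>F k in sequentially. (\<forall>m<n. y (j + t + int m + int (r k)) = l (j + t + int m))
     \<and> int (r k) \<ge> i0 - j - t" by (rule eventually_conj)
  then obtain k where k: "\<forall>m<n. y (j + t + int m + int (r k)) = l (j + t + int m)"
    "int (r k) \<ge> i0 - j - t" by (auto simp: eventually_sequentially)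
  show ?thesis
    using k t by (intro exI[of _ "j + t + int (r k)"]) (auto simp: word_eq_iff algebra_simps list_eq_iff_nth_eq)
qed

lemma periodic_mult:
  fixes x :: "int \<Rightarrow> 'a"
  assumes "\<And>i. x (i + t) = x i"
  shows "x (i + k * t) = x i"
proof (induction k rule: int_induct[where k = 0])
  case (step1 k)
  then show ?case using assms[of "i + k * t"] by (simp add: algebra_simps)
next
  case (step2 k)
  then show ?case using assms[of "i + (k - 1) * t"] by (simp add: algebra_simps)
qed simp

text \<open>By recurrence every word of length \<open>t + 1\<close> would occur in the periodic part, so the
  whole subshift would consist of points of period \<open>t\<close>.\<close>

lemma infinite_minimal_not_eventually_periodic:
  assumes Y: "Y \<in> infinite_minimal_subshifts" and y: "y \<in> Y" and t: "t > 0"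
  shows "\<exists>i\<ge>i0. y (i + int t) \<noteq> y i"
proof (rule ccontr)
  assume "\<not> ?thesis"
  then have per: "y (i + int t) = y i" if "i \<ge> i0" for i using that by blast
  have sub: "subshift Y" and mini: "minimal Y" and inf: "infinite Y"
    using Y by (auto simp: infinite_minimal_subshifts_def)
  have p: "x (i + int t) = x i" if x: "x \<in> Y" for x i
  proof -
    have "word x i (t + 1) \<in> lang (t + 1) Y" using x by (auto simp: lang_def)
    then obtain j where "j \<ge> i0" "word y j (t + 1) = word x i (t + 1)"
      using minimal_recurrence[OF sub mini y] by blast
    then show ?thesis using per[of j] by (auto simp: word_eq_iff dest: spec[of _ 0] spec[of _ t])
  qed
  have "inj_on (\<lambda>x. word x 0 t) Y"
  proof (rule inj_onI, rule ext)
    fix x x' i assume x: "x \<in> Y" "x' \<in> Y" "word x 0 t = word x' 0 t"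
    have "x i = x (i mod int t)" "x' i = x' (i mod int t)"
      using periodic_mult[of x "int t" "i mod int t" "i div int t"] p[OF x(1)]
        periodic_mult[of x' "int t" "i mod int t" "i div int t"] p[OF x(2)]
      by (simp_all add: algebra_simps)
    moreover have "x (int (nat (i mod int t))) = x' (int (nat (i mod int t)))"
      using x(3) t unfolding word_eq_iff by (metis add_0 nat_less_iff of_nat_0_less_iff pos_mod_bound pos_mod_sign)
    ultimately show "x i = x' i" using t by simp
  qed
  moreover have "(\<lambda>x. word x 0 t) ` Y \<subseteq> lang t Y" by (auto simp: lang_def)
  ultimately show False
    using inf finite_lang[OF sub, of t] finite_imageD finite_subset by metis
qed

section \<open>Block parsings\<close>

definition subst_word :: "(int \<Rightarrow> int list) \<Rightarrow> int list \<Rightarrow> int list" where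
  "subst_word f w = concat (map f w)"

lemma subst_word_simps [simp]:
  "subst_word f [] = []" "subst_word f (a # w) = f a @ subst_word f w"
  "subst_word f (v @ w) = subst_word f v @ subst_word f w"
  by (auto simp: subst_word_def)

lemma subst_word_subst_word:
  "subst_word f (subst_word g w) = subst_word (\<lambda>a. subst_word f (g a)) w"
  by (induction w) auto

lemma length_subst_word:
  "(\<And>a. a \<in> set w \<Longrightarrow> length (f a) = L) \<Longrightarrow> length (subst_word f w) = length w * L"
  by (induction w) auto

lemma set_subst_word: "set (subst_word f w) = (\<Union>a\<in>set w. set (f a))"
  by (induction w) auto

lemma subst_word_nth:
  assumes "\<And>a. a \<in> set w \<Longrightarrow> length (f a) = L" "r < length w"
  shows "take L (drop (r * L) (subst_word f w)) = f (w ! r)"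
  using assms
proof (induction w arbitrary: r)
  case (Cons a w)
  have "length (f a) = L" using Cons.prems(1) by simp
  then show ?case using Cons.IH[of "r - 1"] Cons.prems by (cases r) auto
qed simp

lemma subst_word_inj:
  assumes "\<And>a. a \<in> set v \<union> set w \<Longrightarrow> length (f a) = L" "inj_on f (set v \<union> set w)"
    "length v = length w" "subst_word f v = subst_word f w"
  shows "v = w"
proof (rule nth_equalityI)
  fix i assume i: "i < length v"
  then have "f (v ! i) = f (w ! i)"
    using subst_word_nth[of v f L i] subst_word_nth[of w f L i] assms by auto
  then show "v ! i = w ! i" using assms(2,3) i by (auto simp: inj_on_def)
qed (use assms in simp)

lemma take_drop_word:
  "j + k \<le> n \<Longrightarrow> take k (drop j (word x i n)) = word x (i + int j) k"
  by (rule nth_equalityI) (auto simp: algebra_simps)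

text \<open>The point \<open>y\<close> is the image of the sequence \<open>z\<close> under a substitution \<open>f\<close> of constant length
  \<open>L\<close>, with a block starting at position \<open>g\<close>.\<close>
definition parses :: "nat \<Rightarrow> (int \<Rightarrow> int list) \<Rightarrow> int \<Rightarrow> (int \<Rightarrow> int) \<Rightarrow> (int \<Rightarrow> int) \<Rightarrow> bool" where
  "parses L f g z y \<longleftrightarrow> (\<forall>j. word y (g + j * int L) L = f (z j))"

lemma parses_word:
  assumes "parses L f g z y"
  shows "word y (g + j * int L) (n * L) = subst_word f (word z j n)"
proof (induction n arbitrary: j)
  case (Suc n)
  have "word z j (Suc n) = z j # word z (j + 1) n"
    using word_append[of z j 1 n] by (simp add: word_def)
  moreover have "word y (g + j * int L) (Suc n * L)
      = word y (g + j * int L) L @ word y (g + (j + 1) * int L) (n * L)"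
    using word_append[of y "g + j * int L" L "n * L"] by (simp add: algebra_simps)
  ultimately show ?case using Suc[of "j + 1"] assms by (simp add: parses_def)
qed (simp add: word_def)

text \<open>The image of \<open>z\<close> under a substitution \<open>h\<close> of constant length \<open>m\<close>, with the image of
  \<open>z 0\<close> starting at position 0.\<close>
definition spread :: "nat \<Rightarrow> (int \<Rightarrow> int list) \<Rightarrow> (int \<Rightarrow> int) \<Rightarrow> (int \<Rightarrow> int)" where
  "spread m h z = (\<lambda>s. h (z (s div int m)) ! nat (s mod int m))"

text \<open>If the blocks of a parsing are themselves images under a map \<open>f\<close> with blocks of length
  \<open>L\<close>, then the parsing can be refined to one into blocks of \<open>f\<close>.\<close>
lemma parses_spread:
  assumes m: "m > 0" and h: "\<And>j. length (h (z j)) = m"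
    and f: "\<And>j a. a \<in> set (h (z j)) \<Longrightarrow> length (f a) = L"
    and y: "parses (m * L) (\<lambda>a. subst_word f (h a)) g z y"
  shows "parses L f g (spread m h z) y"
  unfolding parses_def
proof
  fix s :: int
  define k r where "k = s div int m" and "r = nat (s mod int m)"
  have r: "r < m" using m by (simp add: r_def nat_less_iff)
  have s: "s = k * int m + int r" using m by (simp add: k_def r_def)
  have rL: "r * L + L \<le> m * L" using r mult_le_mono1[of "Suc r" m L] by simp
  have "word y (g + s * int L) L = take L (drop (r * L) (word y (g + k * int (m * L)) (m * L)))"
    using take_drop_word[OF rL] by (simp add: s algebra_simps)
  also have "word y (g + k * int (m * L)) (m * L) = subst_word f (h (z k))"
    using y by (simp add: parses_def)
  also have "take L (drop (r * L) (subst_word f (h (z k)))) = f (h (z k) ! r)"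
    using subst_word_nth[of "h (z k)" f L r] f h r by simp
  finally show "word y (g + s * int L) L = f (spread m h z s)"
    by (simp add: spread_def k_def r_def)
qed

lemma spread_binary:
  assumes "m > 0" "\<And>j. length (h (z j)) = m" "\<And>j. set (h (z j)) \<subseteq> A"
  shows "spread m h z \<in> full_shift A"
proof -
  have "nat (s mod int m) < length (h (z (s div int m)))" for s
    using assms(1,2) by (simp add: nat_less_iff)
  then show ?thesis using assms(3) nth_mem by (fastforce simp: full_shift_def spread_def)
qed

section \<open>The pattern\<close>

definition head_pattern :: "int list" where
  "head_pattern = [0,0,0,0,1,0,0,0,0,0,0,0,1]"

text \<open>The run lengths 4 and 7 leave room for the losses at the ends of periodic stretches: five
  equal letters in a row occur only inside the run of seven, and after that run the letters
  alternate for long enough to exclude any repetition at the distance where a reversal would put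
  the run of four.  The last three letters make the two images different, supply the pair
  \<open>11\<close>, and end both images in 1.\<close>
definition pattern :: "int \<Rightarrow> int list" where
  "pattern a = head_pattern @ [0,1,0,1] @ (if a = 0 then [0,1,1] else [1,0,1])"

lemma length_pattern [simp]: "length (pattern a) = 20"
  by (simp add: pattern_def head_pattern_def)

lemma set_pattern [simp]: "set (pattern a) = {0, 1}"
  by (auto simp: pattern_def head_pattern_def)

text \<open>Properties of windows of the pattern substitution starting at offset \<open>r\<close> of a block: the
  first locates the run of seven zeros, and the second is the asymmetry of the pattern.\<close>
definition no_run_clash :: "int list \<Rightarrow> nat \<Rightarrow> bool" where
  "no_run_clash w r \<longleftrightarrow>
     ((\<forall>j\<in>set [0..<5]. w ! (r + j) = w ! (r + j + 1)) \<longrightarrow> r = 5 \<or> r = 6) \<and>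
     ((\<forall>j\<in>set [0..<4]. w ! (r + j) = w ! (r + j + 1)) \<longrightarrow> w ! (r + 8) \<noteq> w ! (r + 9))"

lemma pattern_windows:
  "\<forall>r\<in>set [0..<20]. \<forall>a\<in>set [0,1]. \<forall>b\<in>set [0,1]. no_run_clash (pattern a @ pattern b) r"
  by code_simp

text \<open>A window of length 20 meets at most two consecutive blocks, which reduces statements about
  infinite sequences to the finite check above.\<close>
lemma spread_pattern_window:
  assumes "j < 20"
  shows "spread 20 pattern z (s + int j)
    = (pattern (z (s div 20)) @ pattern (z (s div 20 + 1))) ! (nat (s mod 20) + j)"
proof -
  define r k where "r = nat (s mod 20)" and "k = s div 20"
  have r: "r < 20" by (simp add: r_def nat_less_iff)
  have s: "s + int j = int (r + j) + k * 20"
    by (simp add: r_def k_def)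
  show ?thesis
  proof (cases "r + j < 20")
    case True
    then have "(s + int j) div 20 = k" "(s + int j) mod 20 = int (r + j)"
      unfolding s by simp_all
    then show ?thesis using True
      by (simp add: spread_def nth_append flip: r_def k_def del: of_nat_add)
  next
    case False
    then have s: "s + int j = int (r + j - 20) + (k + 1) * 20" using s by simp
    have "int (r + j - 20) < 20" using r assms by simp
    then have "(s + int j) div 20 = k + 1" "(s + int j) mod 20 = int (r + j - 20)"
      unfolding s by (simp_all del: of_nat_diff distrib_right_numeral)
    then show ?thesis using False
      by (simp add: spread_def nth_append flip: r_def k_def del: of_nat_diff)
  qed
qed

lemma spread_pattern_long_run:
  assumes z: "z \<in> full_shift {0, 1}"
    and run: "\<And>j. j < 5 \<Longrightarrow> spread 20 pattern z (s + int j) = spread 20 pattern z (s + int j + 1)"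
  shows "s mod 20 = 5 \<or> s mod 20 = 6"
proof -
  let ?w = "pattern (z (s div 20)) @ pattern (z (s div 20 + 1))"
  have "?w ! (nat (s mod 20) + j) = ?w ! (nat (s mod 20) + j + 1)" if "j < 5" for j
  proof -
    have "?w ! (nat (s mod 20) + j) = spread 20 pattern z (s + int j)"
      using that by (intro spread_pattern_window[symmetric]) simp
    also have "\<dots> = spread 20 pattern z (s + int (j + 1))"
      using run[OF that] by (simp only: of_nat_add of_nat_1 add.assoc)
    also have "\<dots> = ?w ! (nat (s mod 20) + (j + 1))"
      using that by (intro spread_pattern_window) simp
    finally show ?thesis by (simp only: add.assoc)
  qed
  then have "\<forall>j\<in>set [0..<5]. ?w ! (nat (s mod 20) + j) = ?w ! (nat (s mod 20) + j + 1)"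
    by (simp only: set_upt atLeastLessThan_iff Ball_def simp_thms) blast
  moreover have "no_run_clash ?w (nat (s mod 20))"
    using z by (intro pattern_windows[rule_format]) (auto simp: full_shift_def nat_less_iff)
  ultimately have "nat (s mod 20) = 5 \<or> nat (s mod 20) = 6"
    unfolding no_run_clash_def by blast
  moreover have "int (nat (s mod 20)) = s mod 20" by (rule nat_0_le) simp
  ultimately show ?thesis by (metis of_nat_numeral)
qed

lemma spread_pattern_after_run:
  assumes z: "z \<in> full_shift {0, 1}"
    and run: "\<And>j. j < 4 \<Longrightarrow> spread 20 pattern z (s + int j) = spread 20 pattern z (s + int j + 1)"
  shows "spread 20 pattern z (s + 8) \<noteq> spread 20 pattern z (s + 9)"
proof -
  let ?w = "pattern (z (s div 20)) @ pattern (z (s div 20 + 1))"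
  have "?w ! (nat (s mod 20) + j) = ?w ! (nat (s mod 20) + j + 1)" if "j < 4" for j
  proof -
    have "?w ! (nat (s mod 20) + j) = spread 20 pattern z (s + int j)"
      using that by (intro spread_pattern_window[symmetric]) simp
    also have "\<dots> = spread 20 pattern z (s + int (j + 1))"
      using run[OF that] by (simp only: of_nat_add of_nat_1 add.assoc)
    also have "\<dots> = ?w ! (nat (s mod 20) + (j + 1))"
      using that by (intro spread_pattern_window) simp
    finally show ?thesis by (simp only: add.assoc)
  qed
  then have "\<forall>j\<in>set [0..<4]. ?w ! (nat (s mod 20) + j) = ?w ! (nat (s mod 20) + j + 1)"
    by (simp only: set_upt atLeastLessThan_iff Ball_def simp_thms) blast
  moreover have "no_run_clash ?w (nat (s mod 20))"
    using z by (intro pattern_windows[rule_format]) (auto simp: full_shift_def nat_less_iff)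
  ultimately have "?w ! (nat (s mod 20) + 8) \<noteq> ?w ! (nat (s mod 20) + 9)"
    unfolding no_run_clash_def by blast
  moreover have "spread 20 pattern z (s + int 8) = ?w ! (nat (s mod 20) + 8)"
    "spread 20 pattern z (s + int 9) = ?w ! (nat (s mod 20) + 9)"
    by (intro spread_pattern_window; simp only: less_numeral_simps rel_simps)+
  ultimately show ?thesis by (metis of_nat_numeral)
qed

lemma spread_pattern_pairs:
  assumes "a \<in> {0, 1}" "b \<in> {0, 1}"
  shows "\<exists>s. spread 20 pattern z s = a \<and> spread 20 pattern z (s + 1) = b"
proof -
  have v: "spread 20 pattern z (int j) = pattern (z 0) ! j" if "j < 20" for j
    using spread_pattern_window[OF that, of z 0] that by (simp add: nth_append)
  note v' = v[of 0] v[of 1] v[of 3] v[of 4] v[of 5] v[of 16] v[of 17] v[of 18] v[of 19]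
  consider "a = 0 \<and> b = 0" | "a = 0 \<and> b = 1" | "a = 1 \<and> b = 0"
    | "a = 1 \<and> b = 1 \<and> z 0 = 0" | "a = 1 \<and> b = 1 \<and> z 0 \<noteq> 0" using assms by auto
  then show ?thesis
  proof cases
    case 1 then show ?thesis using v'
      by (intro exI[of _ 0]) (simp add: pattern_def head_pattern_def)
  next
    case 2 then show ?thesis using v'
      by (intro exI[of _ 3]) (simp add: pattern_def head_pattern_def)
  next
    case 3 then show ?thesis using v'
      by (intro exI[of _ 4]) (simp add: pattern_def head_pattern_def)
  next
    case 4 then show ?thesis using v'
      by (intro exI[of _ 18]) (simp add: pattern_def head_pattern_def)
  next
    case 5 then show ?thesis using v'
      by (intro exI[of _ 16]) (simp add: pattern_def head_pattern_def)
  qed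
qed

section \<open>Pairs\<close>

type_synonym word_pair = "int list \<times> int list"

definition good :: "word_pair \<Rightarrow> bool" where
  "good p \<longleftrightarrow> length (fst p) = length (snd p) \<and> fst p \<noteq> snd p"

definition pair_word :: "word_pair \<Rightarrow> int \<Rightarrow> int list" where
  "pair_word p a = (if a = 0 then fst p else snd p)"

definition long_word :: "word_pair \<Rightarrow> int \<Rightarrow> int list" where
  "long_word p a = subst_word (pair_word p) (pattern a)"

abbreviation plen :: "word_pair \<Rightarrow> nat" where
  "plen p \<equiv> length (fst p)"

text \<open>The parsing may start anywhere, which makes the set shift invariant.\<close>
definition coded :: "word_pair \<Rightarrow> (int \<Rightarrow> int) set" where
  "coded p = {y. \<exists>g z. z \<in> full_shift {0, 1} \<and> parses (20 * plen p) (long_word p) g z y}"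

lemma length_pair_word: "good p \<Longrightarrow> length (pair_word p a) = plen p"
  by (simp add: good_def pair_word_def)

lemma pair_word_simps [simp]: "pair_word p 0 = fst p" "pair_word p 1 = snd p"
  by (auto simp: pair_word_def)

lemma plen_pos: "good p \<Longrightarrow> plen p > 0"
  by (auto simp: good_def)

lemma length_long_word: "good p \<Longrightarrow> length (long_word p a) = 20 * plen p"
  by (simp add: long_word_def length_subst_word[where L = "plen p"] length_pair_word)

lemma inj_pair_word: "good p \<Longrightarrow> a \<in> {0, 1} \<Longrightarrow> b \<in> {0, 1} \<Longrightarrow> pair_word p a = pair_word p b \<longleftrightarrow> a = b"
  by (auto simp: good_def pair_word_def)

lemma inj_long_word:
  assumes "good p" "a \<in> {0, 1}" "b \<in> {0, 1}"
  shows "long_word p a = long_word p b \<longleftrightarrow> a = b"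
proof
  assume "long_word p a = long_word p b"
  then have "pattern a = pattern b"
    unfolding long_word_def
    by (rule subst_word_inj[where f = "pair_word p" and L = "plen p", rotated 3])
       (use assms(1) in \<open>auto simp: length_pair_word inj_on_def inj_pair_word\<close>)
  then show "a = b" using assms by (auto simp: pattern_def)
qed simp

lemma coded_letters:
  assumes "good p" "parses (20 * plen p) (long_word p) g z y"
  shows "parses (plen p) (pair_word p) g (spread 20 pattern z) y"
  using assms by (intro parses_spread) (auto simp: length_pair_word long_word_def[abs_def])

lemma spread_pattern_binary: "spread 20 pattern z \<in> full_shift {0, 1}"
  by (rule spread_binary) auto

text \<open>A stretch with period \<open>q\<close> contains complete blocks of length \<open>q\<close>, and consecutive
  blocks in it are equal.  The partial block at its start accounts for the \<open>t + 1\<close> in the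
  hypothesis.\<close>
lemma periodic_imp_run:
  assumes p: "good p" and B: "B \<in> full_shift {0, 1}" and y: "parses (plen p) (pair_word p) g B y"
    and per: "\<And>i. l \<le> i \<Longrightarrow> i < l + (int t + 1) * int (plen p) \<Longrightarrow> y (i + int (plen p)) = y i"
    and s: "l \<le> g + s * int (plen p)" "g + s * int (plen p) < l + int (plen p)"
    and j: "j < t"
  shows "B (s + int j) = B (s + int j + 1)"
proof -
  let ?q = "int (plen p)"
  have "word y (g + (s + int j + 1) * ?q) (plen p) = word y (g + (s + int j) * ?q) (plen p)"
    unfolding word_eq_iff
  proof (intro allI impI)
    fix k assume k: "k < plen p"
    let ?i = "g + (s + int j) * ?q + int k"
    have "0 \<le> int j * ?q" by simp
    then have "l \<le> ?i" using s(1) unfolding distrib_right by linarith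
    moreover have "int j * ?q + ?q \<le> int t * ?q"
      using j mult_right_mono[of "int j + 1" "int t" ?q] by (simp add: algebra_simps)
    then have "?i < l + (int t + 1) * ?q" using s(2) k unfolding distrib_right by linarith
    ultimately have "y (?i + ?q) = y ?i" by (rule per)
    then show "y (g + (s + int j + 1) * ?q + int k) = y ?i" by (simp add: algebra_simps)
  qed
  then have "pair_word p (B (s + int j + 1)) = pair_word p (B (s + int j))"
    using y unfolding parses_def by metis
  moreover have "B i \<in> {0, 1}" for i using B by (simp add: full_shift_def)
  ultimately show ?thesis using inj_pair_word[OF p] by metis
qed

lemma block_start_after:
  assumes "q > 0"
  shows "\<exists>s. l \<le> g + s * q \<and> g + s * q < l + (q::int)"
proof -
  define d m where "d = (g - l) div q" and "m = (g - l) mod q"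
  have "g - l = d * q + m" "0 \<le> m" "m < q" using assms by (auto simp: d_def m_def)
  then have "l \<le> g + - d * q" "g + - d * q < l + q" unfolding mult_minus_left by linarith+
  then show ?thesis by blast
qed

definition head_at :: "word_pair \<Rightarrow> (int \<Rightarrow> int) \<Rightarrow> int \<Rightarrow> bool" where
  "head_at p y i \<longleftrightarrow> word y i (13 * plen p) = subst_word (pair_word p) head_pattern"

text \<open>Let \<open>e\<close> be the first position where the two words of the pair differ.  After the run of
  seven equal blocks, period \<open>q\<close> persists for exactly \<open>e\<close> further positions.  So an occurrence of
  the head determines the precise position at which the periodic stretch breaks.\<close>
lemma head_at_defect:
  assumes p: "good p"
  shows "\<exists>e<plen p. \<forall>y i. head_at p y i \<longrightarrow>
    (\<forall>j. i + 5 * int (plen p) \<le> j \<and> j < i + 11 * int (plen p) + int e \<longrightarrow> y (j + int (plen p)) = y j) \<and>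
    y (i + 11 * int (plen p) + int e + int (plen p)) \<noteq> y (i + 11 * int (plen p) + int e)"
proof -
  let ?q = "plen p"
  obtain d where d: "d < ?q" "fst p ! d \<noteq> snd p ! d"
    using p by (auto simp: good_def list_eq_iff_nth_eq)
  obtain e where e: "fst p ! e \<noteq> snd p ! e" "\<And>k. k < e \<Longrightarrow> fst p ! k = snd p ! k"
    using exists_least_iff[of "\<lambda>k. fst p ! k \<noteq> snd p ! k"] d(2) by auto
  have "\<not> d < e" using e(2)[of d] d(2) by blast
  then have eq: "e < ?q" using d(1) by linarith
  show ?thesis
  proof (intro exI[of _ e] conjI allI impI)
    fix y i assume "head_at p y i"
    then have h: "word y i (13 * ?q) = subst_word (pair_word p) head_pattern"
      by (simp add: head_at_def)
    have val: "y (i + int m * int ?q + int k) = pair_word p (head_pattern ! m) ! k"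
      if "m < 13" "k < ?q" for m k
    proof -
      have "m * ?q + ?q \<le> 13 * ?q" using that(1) mult_le_mono1[of "Suc m" 13 ?q] by simp
      then have "word y (i + int (m * ?q)) ?q = take ?q (drop (m * ?q) (word y i (13 * ?q)))"
        by (rule take_drop_word[symmetric])
      also have "\<dots> = pair_word p (head_pattern ! m)"
        unfolding h using that(1)
        by (intro subst_word_nth) (auto simp: length_pair_word[OF p] head_pattern_def)
      finally show ?thesis using that(2) nth_word[of k ?q y "i + int (m * ?q)"] by simp
    qed
    have hp: "head_pattern ! 5 = 0" "head_pattern ! 6 = 0" "head_pattern ! 7 = 0" "head_pattern ! 8 = 0"
      "head_pattern ! 9 = 0" "head_pattern ! 10 = 0" "head_pattern ! 11 = 0" "head_pattern ! 12 = 1"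
      by (auto simp: head_pattern_def)
    show "y (i + 11 * int ?q + int e + int ?q) \<noteq> y (i + 11 * int ?q + int e)"
      using val[of 11 e] val[of 12 e] e(1) eq hp by (simp add: algebra_simps)
    fix j assume j: "i + 5 * int ?q \<le> j \<and> j < i + 11 * int ?q + int e"
    define m k where "m = nat ((j - i) div int ?q)" and "k = nat ((j - i) mod int ?q)"
    have q: "int ?q > 0" using plen_pos[OF p] by simp
    have "(j - i) div int ?q \<ge> 5 * int ?q div int ?q" using j q by (intro zdiv_mono1) auto
    then have m5: "m \<ge> 5" and dpos: "(j - i) div int ?q \<ge> 0" using q by (auto simp: m_def)
    have k: "k < ?q" using q by (simp add: k_def nat_less_iff)
    have jj: "j = i + int m * int ?q + int k" using q dpos by (simp add: m_def k_def)
    have "m < 12"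
    proof (rule ccontr)
      assume "\<not> m < 12"
      then have "int m * int ?q \<ge> 12 * int ?q" by (intro mult_right_mono) auto
      then show False using j eq jj by linarith
    qed
    then consider "m < 11" | "m = 11" by linarith
    then have "pair_word p (head_pattern ! Suc m) ! k = pair_word p (head_pattern ! m) ! k"
    proof cases
      case 1
      then have "m \<in> {5,6,7,8,9,10}" using m5 by auto
      then show ?thesis using hp by auto
    next
      case 2
      then have "k < e" using j jj by simp
      then show ?thesis using 2 hp e(2) by simp
    qed
    then show "y (j + int ?q) = y j"
      using val[of m k] val[of "Suc m" k] \<open>m < 12\<close> k by (simp add: jj algebra_simps)
  qed (rule eq)
qed

lemma parses_head_at:
  assumes "good p" "parses (20 * plen p) (long_word p) g z y"
  shows "head_at p y (g + k * int (20 * plen p))"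
proof -
  have "word y (g + k * int (20 * plen p)) (13 * plen p) = take (13 * plen p) (long_word p (z k))"
    using assms(2)[unfolded parses_def, rule_format, of k]
      take_drop_word[of 0 "13 * plen p" "20 * plen p" y "g + k * int (20 * plen p)"] by simp
  moreover have "length (subst_word (pair_word p) head_pattern) = 13 * plen p"
    by (subst length_subst_word[where L = "plen p"])
      (auto simp: length_pair_word[OF assms(1)], simp add: head_pattern_def)
  ultimately show ?thesis by (simp add: head_at_def long_word_def pattern_def)
qed

text \<open>The periodic stretch in an occurrence of the head at \<open>i\<close> must lie in the long run of some long
  word, starting at \<open>g0\<close> say, and then \<open>i\<close> and \<open>g0\<close> differ by at most \<open>q\<close>.  The head also
  occurs at \<open>g0\<close>.  If \<open>i\<close> and \<open>g0\<close> were different, the break of period belonging to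
  the smaller one would fall into the periodic stretch of the other.\<close>
lemma head_at_cut:
  assumes p: "good p" and z: "z \<in> full_shift {0, 1}"
    and y: "parses (20 * plen p) (long_word p) g z y" and i: "head_at p y i"
  shows "\<exists>k. i = g + k * int (20 * plen p)"
proof -
  let ?q = "int (plen p)"
  have q: "?q > 0" using plen_pos[OF p] by simp
  obtain e where e: "e < plen p" 
    "\<And>i j. head_at p y i \<Longrightarrow> i + 5 * ?q \<le> j \<Longrightarrow> j < i + 11 * ?q + int e \<Longrightarrow> y (j + ?q) = y j"
    "\<And>i. head_at p y i \<Longrightarrow> y (i + 11 * ?q + int e + ?q) \<noteq> y (i + 11 * ?q + int e)"
    using head_at_defect[OF p] by metis
  let ?B = "spread 20 pattern z"
  obtain s where s: "i + 5 * ?q \<le> g + s * ?q" "g + s * ?q < i + 5 * ?q + ?q"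
    using block_start_after[OF q] by blast
  have "?B (s + int j) = ?B (s + int j + 1)" if "j < 5" for j
    by (rule periodic_imp_run[OF p spread_pattern_binary coded_letters[OF p y] _ s that])
       (rule e(2)[OF i], auto)
  then have s56: "s mod 20 = 5 \<or> s mod 20 = 6" by (rule spread_pattern_long_run[OF z])
  define k where "k = s div 20"
  define g0 where "g0 = g + k * int (20 * plen p)"
  have g0: "head_at p y g0" unfolding g0_def by (rule parses_head_at[OF p y])
  have "s = 20 * k + s mod 20" by (simp add: k_def)
  then have "s * ?q = k * (20 * ?q) + (s mod 20) * ?q" by (metis distrib_right mult.assoc mult.commute)
  then have "g + s * ?q = g0 + (s mod 20) * ?q" by (simp add: g0_def)
  then have near: "g0 - i < ?q" "i - g0 \<le> ?q" using s s56 q by auto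
  have "\<not> g0 > i"
    using e(2)[OF g0, of "i + 11 * ?q + int e"] e(3)[OF i] near q by auto
  moreover have "\<not> g0 < i"
    using e(2)[OF i, of "g0 + 11 * ?q + int e"] e(3)[OF g0] near q by auto
  ultimately have "i = g0" by linarith
  then show ?thesis unfolding g0_def by blast
qed

section \<open>The subshift coded by a pair\<close>

lemma word_eq_sub:
  "word y i n = word c j n \<Longrightarrow> a + b \<le> n \<Longrightarrow> word y (i + int a) b = word c (j + int a) b"
  using take_drop_word[of a b n y i] take_drop_word[of a b n c j] by simp

lemma coded_translate:
  assumes "y \<in> coded p" shows "(\<lambda>i. y (i + k)) \<in> coded p"
proof -
  obtain g z where "z \<in> full_shift {0, 1}" "parses (20 * plen p) (long_word p) g z y"
    using assms by (auto simp: coded_def)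
  then show ?thesis unfolding coded_def parses_def
    by (intro CollectI exI[of _ "g - k"] exI[of _ z]) (simp add: word_translate algebra_simps)
qed

lemma head_at_window:
  assumes "word y i n = word c j n" "a + 13 * plen p \<le> n"
  shows "head_at p y (i + int a) \<longleftrightarrow> head_at p c (j + int a)"
  using word_eq_sub[OF assms] by (simp add: head_at_def)

text \<open>Windows of two long words suffice: a window that starts with the head agrees with a coded
  point in which the head is the start of a long word, so that a full long word and the next
  head follow; the same works to the left.\<close>
lemma coded_local:
  assumes p: "good p"
    and y: "\<And>i. word y i (40 * plen p) \<in> lang (40 * plen p) (coded p)"
  shows "y \<in> coded p"
proof -
  let ?M = "20 * plen p"
  have window: "\<exists>c g z j. z \<in> full_shift {0, 1} \<and> parses ?M (long_word p) g z c
      \<and> word y i (40 * plen p) = word c j (40 * plen p)" for i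
    using y[of i] by (auto simp: lang_def coded_def)
  have fwd: "(word y i ?M = long_word p 0 \<or> word y i ?M = long_word p 1) \<and> head_at p y (i + int ?M)"
    if i: "head_at p y i" for i
  proof -
    obtain c g z j where c: "z \<in> full_shift {0, 1}" "parses ?M (long_word p) g z c"
      "word y i (40 * plen p) = word c j (40 * plen p)" using window by blast
    have "head_at p c j" using head_at_window[OF c(3), of 0] i by simp
    then obtain k where k: "j = g + k * int ?M" using head_at_cut[OF p c(1,2)] by blast
    have "word y i ?M = word c j ?M" using word_eq_sub[OF c(3), of 0 ?M] by simp
    also have "\<dots> = long_word p (z k)" using c(2) by (simp add: parses_def k)
    finally have "word y i ?M = long_word p (z k)" .
    moreover have "z k = 0 \<or> z k = 1" using c(1) by (auto simp: full_shift_def)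
    moreover have "head_at p c (j + int ?M)"
      using parses_head_at[OF p c(2), of "k + 1"] by (simp add: k algebra_simps)
    then have "head_at p y (i + int ?M)" using head_at_window[OF c(3), of ?M] by simp
    ultimately show ?thesis by metis
  qed
  have bwd: "head_at p y (i - int ?M)" if i: "head_at p y i" for i
  proof -
    obtain c g z j where c: "z \<in> full_shift {0, 1}" "parses ?M (long_word p) g z c"
      "word y (i - int ?M) (40 * plen p) = word c j (40 * plen p)" using window by blast
    have "head_at p c (j + int ?M)" using head_at_window[OF c(3), of ?M] i by simp
    then obtain k where "j + int ?M = g + k * int ?M" using head_at_cut[OF p c(1,2)] by blast
    then have "j = g + (k - 1) * int ?M" by (simp add: algebra_simps)
    then have "head_at p c j" using parses_head_at[OF p c(2)] by blast
    then show ?thesis using head_at_window[OF c(3), of 0] by simp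
  qed
  obtain i0 where i0: "head_at p y i0"
  proof -
    obtain c g z j where c: "z \<in> full_shift {0, 1}" "parses ?M (long_word p) g z c"
      "word y 0 (40 * plen p) = word c j (40 * plen p)" using window by blast
    have "int ?M > 0" using plen_pos[OF p] by simp
    then obtain s where s: "j \<le> g + s * int ?M" "g + s * int ?M < j + int ?M"
      using block_start_after by blast
    define a where "a = nat (g + s * int ?M - j)"
    have "j + int a = g + s * int ?M" using s by (simp add: a_def)
    then have "head_at p c (j + int a)" using parses_head_at[OF p c(2)] by metis
    moreover have "a + 13 * plen p \<le> 40 * plen p" using s by (auto simp: a_def nat_le_iff)
    ultimately show ?thesis using head_at_window[OF c(3), of a p] that by metis
  qed
  have all: "head_at p y (i0 + k * int ?M)" for k
  proof (induction k rule: int_induct[where k = 0])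
    case base then show ?case using i0 by simp
  next
    case (step1 k)
    then show ?case using fwd[of "i0 + k * int ?M"] by (simp add: algebra_simps)
  next
    case (step2 k)
    then show ?case using bwd[of "i0 + k * int ?M"] by (simp add: algebra_simps)
  qed
  define z where "z k = (if word y (i0 + k * int ?M) ?M = long_word p 0 then 0 else (1::int))" for k
  have "z \<in> full_shift {0, 1}" by (auto simp: z_def full_shift_def)
  moreover have "parses ?M (long_word p) i0 z y"
    unfolding parses_def
  proof
    fix k show "word y (i0 + k * int ?M) ?M = long_word p (z k)"
      using fwd[OF all[of k]] by (auto simp: z_def)
  qed
  ultimately show ?thesis by (auto simp: coded_def)
qed

definition pair_lang :: "word_pair \<Rightarrow> nat \<Rightarrow> int list set" where
  "pair_lang p n = {take n (drop j (pair_word p a @ pair_word p b)) | a b j.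
     a \<in> {0, 1} \<and> b \<in> {0, 1} \<and> j + n \<le> 2 * plen p}"

lemma words_coded:
  assumes p: "good p" and y: "y \<in> coded p" and n: "n \<le> plen p"
  shows "{word y i n | i. True} = pair_lang p n"
proof -
  let ?q = "plen p"
  obtain g z where z: "parses (20 * ?q) (long_word p) g z y"
    using y by (auto simp: coded_def)
  let ?B = "spread 20 pattern z"
  have two: "word y (g + s * int ?q) (2 * ?q) = pair_word p (?B s) @ pair_word p (?B (s + 1))" for s
    using coded_letters[OF p z] word_append[of y "g + s * int ?q" ?q ?q]
    unfolding parses_def by (metis (no_types, lifting) add.assoc distrib_right mult_1 mult_2)
  have B: "?B s \<in> {0, 1}" for s using spread_pattern_binary by (auto simp: full_shift_def)
  show ?thesis
  proof (intro equalityI subsetI)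
    fix w assume "w \<in> {word y i n | i. True}"
    then obtain i where i: "w = word y i n" by blast
    have q: "int ?q > 0" using plen_pos[OF p] by simp
    define s j where "s = (i - g) div int ?q" and "j = nat ((i - g) mod int ?q)"
    have j: "j < ?q" "i = g + s * int ?q + int j" using q by (auto simp: s_def j_def nat_less_iff)
    then have "w = take n (drop j (word y (g + s * int ?q) (2 * ?q)))"
      using n i by (subst take_drop_word) auto
    then show "w \<in> pair_lang p n" unfolding two pair_lang_def using B j n by fastforce
  next
    fix w assume "w \<in> pair_lang p n"
    then obtain a b j where w: "w = take n (drop j (pair_word p a @ pair_word p b))"
      "a \<in> {0, 1}" "b \<in> {0, 1}" "j + n \<le> 2 * ?q" unfolding pair_lang_def by blast
    obtain s where "?B s = a" "?B (s + 1) = b" using spread_pattern_pairs[OF w(2,3)] by blast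
    then have "w = word y (g + s * int ?q + int j) n"
      using two[of s] w take_drop_word[OF w(4)] by metis
    then show "w \<in> {word y i n | i. True}" by blast
  qed
qed

lemma lang_coded:
  assumes "good p" "X \<subseteq> coded p" "X \<noteq> {}" "n \<le> plen p"
  shows "lang n X = pair_lang p n"
proof -
  have "lang n X = (\<Union>x\<in>X. {word x i n | i. True})" by (auto simp: lang_def)
  also have "\<dots> = pair_lang p n" using words_coded[of p _ n] assms by (simp add: subset_iff)
  finally show ?thesis .
qed

lemma coded_nonempty: "good p \<Longrightarrow> coded p \<noteq> {}"
proof -
  assume p: "good p"
  let ?M = "20 * plen p"
  let ?y = "\<lambda>i. long_word p 0 ! nat (i mod int ?M)"
  have "parses ?M (long_word p) 0 (\<lambda>_. 0) ?y"
    unfolding parses_def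
    by (intro allI nth_equalityI) (auto simp: length_long_word[OF p] nat_mod_distrib zmod_int)
  then have "?y \<in> coded p" by (auto simp: coded_def full_shift_def)
  then show ?thesis by blast
qed

lemma coded_subset_full_shift:
  assumes p: "good p" shows "coded p \<subseteq> full_shift (set (fst p) \<union> set (snd p))"
proof
  fix y assume y: "y \<in> coded p"
  have "y i \<in> set (fst p) \<union> set (snd p)" for i
  proof -
    have "1 \<le> plen p" using plen_pos[OF p] by linarith
    then have "word y i 1 \<in> pair_lang p 1" using words_coded[OF p y] by blast
    then obtain a b j where w: "[y i] = take 1 (drop j (pair_word p a @ pair_word p b))"
      by (auto simp: pair_lang_def word_def)
    have "y i \<in> set (take 1 (drop j (pair_word p a @ pair_word p b)))" unfolding w[symmetric] by simp
    then have "y i \<in> set (pair_word p a @ pair_word p b)" by (meson in_set_dropD in_set_takeD)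
    then show ?thesis by (auto simp: pair_word_def split: if_splits)
  qed
  then show "y \<in> full_shift (set (fst p) \<union> set (snd p))" by (simp add: full_shift_def)
qed

lemma closed_coded:
  assumes p: "good p" shows "closed (coded p)"
proof -
  have "closure (coded p) \<subseteq> coded p"
  proof
    fix y assume y: "y \<in> closure (coded p)"
    show "y \<in> coded p"
    proof (rule coded_local[OF p])
      fix i obtain c where "c \<in> coded p" "word c i (40 * plen p) = word y i (40 * plen p)"
        using closure_agree[OF y] by blast
      then show "word y i (40 * plen p) \<in> lang (40 * plen p) (coded p)"
        unfolding lang_def by (metis (mono_tags, lifting) mem_Collect_eq)
    qed
  qed
  then show ?thesis by (simp add: closure_subset_eq)
qed

section \<open>Refining pairs\<close>

text \<open>The pair \<open>e\<close> records how the words of \<open>p'\<close> are composed of the long words of \<open>p\<close>.\<close>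
definition pair_refines :: "word_pair \<Rightarrow> word_pair \<Rightarrow> bool" where
  "pair_refines p p' \<longleftrightarrow> (\<exists>e. good e \<and> set (fst e) \<subseteq> {0, 1} \<and> set (snd e) \<subseteq> {0, 1} \<and>
     p' = (subst_word (long_word p) (fst e), subst_word (long_word p) (snd e)))"

lemma refines_good:
  assumes p: "good p" and r: "pair_refines p p'"
  shows "good p'" "20 * plen p \<le> plen p'"
proof -
  obtain e where e: "good e" "set (fst e) \<subseteq> {0, 1}" "set (snd e) \<subseteq> {0, 1}"
     "p' = (subst_word (long_word p) (fst e), subst_word (long_word p) (snd e))"
    using r by (auto simp: pair_refines_def)
  have l: "length (subst_word (long_word p) w) = length w * (20 * plen p)" for w
    by (rule length_subst_word) (simp add: length_long_word[OF p])
  have "subst_word (long_word p) (fst e) \<noteq> subst_word (long_word p) (snd e)"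
  proof
    assume "subst_word (long_word p) (fst e) = subst_word (long_word p) (snd e)"
    then have "fst e = snd e"
      by (rule subst_word_inj[where f = "long_word p" and L = "20 * plen p", rotated 3])
        (use e p inj_long_word[OF p] in \<open>auto simp: length_long_word inj_on_def good_def subset_iff\<close>)
    then show False using e(1) by (simp add: good_def)
  qed
  then show "good p'" using e(1) unfolding e(4) good_def by (simp add: l)
  have "1 * (20 * plen p) \<le> plen e * (20 * plen p)"
    using plen_pos[OF e(1)] by (intro mult_le_mono1) linarith
  then show "20 * plen p \<le> plen p'" unfolding e(4) by (simp add: l)
qed

lemma refines_coded:
  assumes p: "good p" and r: "pair_refines p p'"
  shows "coded p' \<subseteq> coded p"
proof
  obtain e where e: "good e" "set (fst e) \<subseteq> {0, 1}" "set (snd e) \<subseteq> {0, 1}"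
     "p' = (subst_word (long_word p) (fst e), subst_word (long_word p) (snd e))"
    using r by (auto simp: pair_refines_def)
  fix y assume "y \<in> coded p'"
  then obtain g z where "parses (20 * plen p') (long_word p') g z y" by (auto simp: coded_def)
  then have y: "parses (plen p') (pair_word p') g (spread 20 pattern z) y"
    by (rule coded_letters[OF refines_good(1)[OF p r]])
  have "plen p' = plen e * (20 * plen p)" unfolding e(4)
    by (simp add: length_subst_word[where L = "20 * plen p"] length_long_word[OF p])
  moreover have "pair_word p' = (\<lambda>a. subst_word (long_word p) (pair_word e a))"
    unfolding e(4) by (auto simp: pair_word_def)
  ultimately have "parses (plen e * (20 * plen p)) (\<lambda>a. subst_word (long_word p) (pair_word e a)) g
      (spread 20 pattern z) y" using y by simp
  then have "parses (20 * plen p) (long_word p) g (spread (plen e) (pair_word e) (spread 20 pattern z)) y"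
    by (intro parses_spread[OF plen_pos[OF e(1)]] length_pair_word[OF e(1)] length_long_word[OF p])
  moreover have "spread (plen e) (pair_word e) (spread 20 pattern z) \<in> full_shift {0, 1}"
    by (rule spread_binary[OF plen_pos[OF e(1)] length_pair_word[OF e(1)]])
      (use e in \<open>auto simp: pair_word_def\<close>)
  ultimately show "y \<in> coded p" by (auto simp: coded_def)
qed

definition refining_chain :: "(nat \<Rightarrow> word_pair) \<Rightarrow> bool" where
  "refining_chain P \<longleftrightarrow> good (P 0) \<and> (\<forall>k. pair_refines (P k) (P (Suc k)))"

lemma chain_good: "refining_chain P \<Longrightarrow> good (P k)"
  by (induction k) (auto simp: refining_chain_def refines_good)

lemma chain_plen:
  assumes P: "refining_chain P" shows "k < plen (P k)"
proof (induction k)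
  case 0 then show ?case using plen_pos chain_good[OF P] by blast
next
  case (Suc k)
  have "20 * plen (P k) \<le> plen (P (Suc k))"
    using refines_good(2)[OF chain_good[OF P]] P by (simp add: refining_chain_def)
  then show ?case using Suc by linarith
qed

lemma chain_coded_antimono:
  assumes P: "refining_chain P" "j \<le> k" shows "coded (P k) \<subseteq> coded (P j)"
  using assms(2)
proof (induction rule: dec_induct)
  case (step n)
  then show ?case using refines_coded[OF chain_good[OF P(1)], of n "P (Suc n)"] P
    by (auto simp: refining_chain_def)
qed simp

definition chain_limit :: "(nat \<Rightarrow> word_pair) \<Rightarrow> (int \<Rightarrow> int) set" where
  "chain_limit P = (\<Inter>k. coded (P k))"

text \<open>A decreasing sequence of nonempty compact sets.\<close>
lemma chain_limit_nonempty:
  assumes P: "refining_chain P" shows "chain_limit P \<noteq> {}"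
proof -
  have "\<forall>k. \<exists>y. y \<in> coded (P k)" using coded_nonempty chain_good[OF P] by blast
  then obtain y where y: "\<And>k. y k \<in> coded (P k)" by metis
  let ?A = "set (fst (P 0)) \<union> set (snd (P 0))"
  have "seq_compact (full_shift ?A)" by (intro compact_imp_seq_compact compact_full_shift) simp
  moreover have "\<forall>k. y k \<in> full_shift ?A"
    using y chain_coded_antimono[OF P, of 0] coded_subset_full_shift[OF chain_good[OF P, of 0]] by blast
  ultimately obtain l r where l: "strict_mono (r::nat\<Rightarrow>nat)" "(y \<circ> r) \<longlonglongrightarrow> l"
    unfolding seq_compact_def by metis
  have "l \<in> coded (P k)" for k
  proof (rule closed_sequentially[OF closed_coded[OF chain_good[OF P]]])
    show "(\<lambda>m. (y \<circ> r) (m + k)) \<longlonglongrightarrow> l" using l(2) by (rule LIMSEQ_ignore_initial_segment)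
    fix m have "k \<le> r (m + k)" using seq_suble[OF l(1), of "m + k"] by simp
    then show "(y \<circ> r) (m + k) \<in> coded (P k)" using y chain_coded_antimono[OF P] by fastforce
  qed
  then show ?thesis by (auto simp: chain_limit_def)
qed

lemma closure_agreeI:
  fixes y :: "int \<Rightarrow> int"
  assumes "\<And>n. \<exists>x\<in>S. word x (- int n) (2 * n + 1) = word y (- int n) (2 * n + 1)"
  shows "y \<in> closure S"
proof -
  obtain x where x: "\<And>n. x n \<in> S" "\<And>n. word (x n) (- int n) (2 * n + 1) = word y (- int n) (2 * n + 1)"
    using assms by metis
  have "x \<longlonglongrightarrow> y" unfolding tendsto_fun_int_iff
  proof
    fix i :: int
    show "\<forall>\<^sub>F n in sequentially. x n i = y i"
    proof (rule eventually_sequentiallyI[of "nat \<bar>i\<bar>"])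
      fix n assume "nat \<bar>i\<bar> \<le> n"
      then have "nat (i + int n) < 2 * n + 1" "- int n + int (nat (i + int n)) = i" by auto
      then show "x n i = y i" using x(2)[of n] unfolding word_eq_iff by metis
    qed
  qed
  then show ?thesis using x(1) by (auto simp: closure_sequential)
qed

lemma translate_closed_shift:
  assumes "\<And>x k. x \<in> X \<Longrightarrow> (\<lambda>i. x (i + k)) \<in> X"
  shows "shift ` X = X"
proof
  show "shift ` X \<subseteq> X" using assms[of _ 1] by (auto simp: shift_def)
  show "X \<subseteq> shift ` X"
  proof
    fix x assume "x \<in> X"
    then have "(\<lambda>i. x (i - 1)) \<in> X" using assms[of x "-1"] by simp
    moreover have "x = shift (\<lambda>i. x (i - 1))" by (simp add: shift_def)
    ultimately show "x \<in> shift ` X" by blast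
  qed
qed

text \<open>All points of the limit have the same words, since \<open>words_coded\<close> applies at every level;
  this is minimality.  If the limit were finite, some point would have a period \<open>t\<close>; but heads of
  level \<open>t\<close> only occur at distances that are multiples of a number larger than \<open>t\<close>.\<close>
lemma chain_limit_infinite_minimal:
  assumes P: "refining_chain P" shows "chain_limit P \<in> infinite_minimal_subshifts"
proof -
  note good = chain_good[OF P]
  let ?X = "chain_limit P"
  have sub: "?X \<subseteq> coded (P k)" for k by (auto simp: chain_limit_def)
  have tr: "(\<lambda>i. x (i + k)) \<in> ?X" if "x \<in> ?X" for x k
    using that coded_translate by (auto simp: chain_limit_def)
  have "\<exists>A. finite A \<and> ?X \<subseteq> full_shift A"
    using sub[of 0] coded_subset_full_shift[OF good, of 0]
    by (intro exI[of _ "set (fst (P 0)) \<union> set (snd (P 0))"]) auto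
  moreover have "closed ?X" unfolding chain_limit_def using closed_coded[OF good] by blast
  moreover have "shift ` ?X = ?X" by (rule translate_closed_shift) (rule tr)
  ultimately have "subshift ?X" by (simp add: subshift_def)
  moreover have "minimal ?X" unfolding minimal_def
  proof (intro ballI subsetI closure_agreeI)
    fix x y n assume xy: "x \<in> ?X" "y \<in> ?X"
    have "2 * n + 1 \<le> plen (P (2 * n + 1))" using chain_plen[OF P] by (rule less_imp_le)
    then have "{word y i (2 * n + 1) | i. True} = {word x i (2 * n + 1) | i. True}"
      using words_coded[OF good] xy sub by blast
    then obtain i where "word y (- int n) (2 * n + 1) = word x i (2 * n + 1)" by blast
    then have "word (\<lambda>k. x (k + (i + int n))) (- int n) (2 * n + 1) = word y (- int n) (2 * n + 1)"
      by (simp add: word_translate)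
    then show "\<exists>z\<in>orbit x. word z (- int n) (2 * n + 1) = word y (- int n) (2 * n + 1)"
      unfolding orbit_def by blast
  qed
  moreover have "infinite ?X"
  proof
    assume fin: "finite ?X"
    obtain x where x: "x \<in> ?X" using chain_limit_nonempty[OF P] by blast
    have "finite (range (\<lambda>k i. x (i + int k)))"
      using fin by (rule finite_subset[rotated]) (use tr[OF x] in auto)
    then have "\<not> inj (\<lambda>k i. x (i + int k))" using finite_imageD by blast
    then obtain a b where ab: "a < b" "(\<lambda>i. x (i + int a)) = (\<lambda>i. x (i + int b))"
      unfolding inj_def by (metis linorder_neqE_nat)
    define t where "t = b - a"
    have per: "x (i + int t) = x i" for i
      using fun_cong[OF ab(2), of "i - int a"] ab(1) by (simp add: t_def of_nat_diff algebra_simps)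
    \<comment> \<open>level \<open>t\<close> is coarse enough, since \<open>k < plen (P k)\<close> for all \<open>k\<close>\<close>
    let ?p = "P t"
    obtain g z where z: "z \<in> full_shift {0, 1}" "parses (20 * plen ?p) (long_word ?p) g z x"
      using x sub[of t] by (auto simp: coded_def)
    have "head_at ?p x (g + 0 * int (20 * plen ?p))" by (rule parses_head_at[OF good z(2)])
    moreover have "word x (g + int t) m = word x g m" for m
      using per by (simp add: word_eq_iff) (metis add.commute add.left_commute)
    ultimately have "head_at ?p x (g + int t)" by (simp add: head_at_def)
    then obtain k where "g + int t = g + k * int (20 * plen ?p)" using head_at_cut[OF good z] by blast
    then have "int t = k * int (20 * plen ?p)" by simp
    then have "20 * plen ?p dvd t" by (metis dvd_triv_right int_dvd_int_iff)
    moreover have "t > 0" "t < plen ?p" using ab(1) chain_plen[OF P] by (auto simp: t_def)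
    ultimately have "20 * plen ?p \<le> t" by (intro dvd_imp_le)
    then show False using \<open>t < plen ?p\<close> by linarith
  qed
  ultimately show ?thesis by (simp add: infinite_minimal_subshifts_def)
qed

lemma minimal_eq_chain_limit:
  assumes P: "refining_chain P" and X: "subshift X" "X \<noteq> {}" and sub: "\<And>k. X \<subseteq> coded (P k)"
  shows "X = chain_limit P"
proof
  show "X \<subseteq> chain_limit P" using sub by (auto simp: chain_limit_def)
  have "lang n (chain_limit P) \<subseteq> lang n X" for n
    using lang_coded[OF chain_good[OF P], of X n n] lang_coded[OF chain_good[OF P], of "chain_limit P" n n]
      sub X(2) chain_limit_nonempty[OF P] chain_plen[OF P, of n] by (auto simp: chain_limit_def)
  then show "chain_limit P \<subseteq> X"
    using lang_subset_imp_subset chain_limit_infinite_minimal[OF P] X(1)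
    by (auto simp: infinite_minimal_subshifts_def)
qed

section \<open>No reversal\<close>

lemma run_imp_periodic:
  assumes p: "good p" and y: "parses (plen p) (pair_word p) g B y"
    and run: "\<And>j. j < t \<Longrightarrow> B (s + int j) = B (s + int j + 1)"
    and i: "g + s * int (plen p) \<le> i" "i < g + (s + int t) * int (plen p)"
  shows "y (i + int (plen p)) = y i"
proof -
  let ?q = "int (plen p)"
  have q: "?q > 0" using plen_pos[OF p] by simp
  define m k where "m = (i - g) div ?q" and "k = nat ((i - g) mod ?q)"
  have k: "k < plen p" "i = g + m * ?q + int k" using q by (auto simp: m_def k_def nat_less_iff)
  have "s * ?q div ?q \<le> m" unfolding m_def using i(1) q by (intro zdiv_mono1) auto
  then have "s \<le> m" using q by simp
  moreover have "m < s + int t"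
  proof (rule ccontr)
    assume "\<not> m < s + int t"
    then have "(s + int t) * ?q \<le> m * ?q" by (intro mult_right_mono) auto
    then show False using i(2) k by linarith
  qed
  ultimately have "B m = B (m + 1)" using run[of "nat (m - s)"] by auto
  then have "word y (g + m * ?q) (plen p) = word y (g + (m + 1) * ?q) (plen p)"
    using y by (simp add: parses_def)
  then have "y (g + m * ?q + int k) = y (g + (m + 1) * ?q + int k)"
    using k(1) by (simp add: word_eq_iff)
  then show ?thesis unfolding k(2) by (simp add: algebra_simps)
qed

text \<open>Here \<open>y'\<close> is the image of \<open>y\<close> under a reversing block code of radius \<open>r\<close>.  The stretches
  of period \<open>q\<close> in \<open>y\<close> over \<open>x\<^sup>7\<close> and over the preceding \<open>x\<^sup>4\<close> become stretches of
  \<open>y'\<close> in the opposite order, shorter by \<open>2 * r\<close>, whose starting points are \<open>8 * q\<close> apart.  So the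
  blocks of \<open>y'\<close> have a run of five followed by a repetition eight blocks later, which the
  pattern excludes.\<close>
lemma no_local_reversal:
  assumes p: "good p" and y: "y \<in> coded p" and y': "y' \<in> coded p"
    and r: "2 * r \<le> int (plen p)"
    and loc: "\<And>i i'. (\<And>j. \<bar>j\<bar> \<le> r \<Longrightarrow> y (j - i) = y (j - i')) \<Longrightarrow> y' i = y' i'"
  shows False
proof -
  let ?q = "int (plen p)"
  have q: "?q > 0" using plen_pos[OF p] by simp
  obtain g z where z: "z \<in> full_shift {0, 1}" "parses (20 * plen p) (long_word p) g z y"
    using y by (auto simp: coded_def)
  obtain g' z' where z': "z' \<in> full_shift {0, 1}" "parses (20 * plen p) (long_word p) g' z' y'"
    using y' by (auto simp: coded_def)
  have B: "spread 20 pattern z (int j) = pattern (z 0) ! j" if "j < 20" for j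
    using spread_pattern_window[OF that, of z 0] that by (simp add: nth_append)
  have short: "spread 20 pattern z (0 + int j) = spread 20 pattern z (0 + int j + 1)" if "j < 3" for j
  proof -
    have "j \<in> {0, 1, 2}" using that by auto
    then show ?thesis using B[of j] B[of "Suc j"] that
      by (auto simp: pattern_def head_pattern_def add.commute)
  qed
  have long: "spread 20 pattern z (5 + int j) = spread 20 pattern z (5 + int j + 1)" if "j < 6" for j
  proof -
    have "j \<in> {0, 1, 2, 3, 4, 5}" using that by auto
    then show ?thesis using B[of "j + 5"] B[of "j + 6"] that
      by (auto simp: pattern_def head_pattern_def add.commute)
  qed
  note run = run_imp_periodic[OF p coded_letters[OF p z(2)]]
  have per: "y' (i + ?q) = y' i"
    if "\<And>i. l \<le> i \<Longrightarrow> i < h \<Longrightarrow> y (i + ?q) = y i" "- h - ?q + r < i" "i \<le> - l - ?q - r" for l h i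
  proof (rule loc)
    fix j assume "\<bar>j\<bar> \<le> r"
    then have "y (j - i - ?q + ?q) = y (j - i - ?q)" using that(2,3) by (intro that(1)) auto
    then show "y (j - (i + ?q)) = y (j - i)" by (simp add: algebra_simps)
  qed
  \<comment> \<open>where the image of the periodic stretch over \<open>x\<^sup>7\<close> begins\<close>
  define l where "l = - g - 12 * ?q + r + 1"
  have perA: "y' (i + ?q) = y' i" if "l \<le> i" "i < l + (int 4 + 1) * ?q" for i
  proof (rule per)
    show "y (i + ?q) = y i" if "g + 5 * ?q \<le> i" "i < g + (5 + int 6) * ?q" for i
      using run[of 6 5 i] long that by simp
  qed (use that r in \<open>auto simp: l_def\<close>)
  have perB: "y' (i + ?q) = y' i" if "l + 8 * ?q \<le> i" "i < l + 8 * ?q + (int 1 + 1) * ?q" for i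
  proof (rule per)
    show "y (i + ?q) = y i" if "g + 0 * ?q \<le> i" "i < g + (0 + int 3) * ?q" for i
      using run[of 3 0 i] short that by simp
  qed (use that r in \<open>auto simp: l_def\<close>)
  obtain s where s: "l \<le> g' + s * ?q" "g' + s * ?q < l + ?q"
    using block_start_after[OF q] by blast
  note run' = periodic_imp_run[OF p spread_pattern_binary coded_letters[OF p z'(2)]]
  have "spread 20 pattern z' (s + int j) = spread 20 pattern z' (s + int j + 1)" if "j < 4" for j
    by (rule run'[OF perA s that])
  then have "spread 20 pattern z' (s + 8) \<noteq> spread 20 pattern z' (s + 9)"
    by (rule spread_pattern_after_run[OF z'(1)])
  moreover have "spread 20 pattern z' (s + 8 + int 0) = spread 20 pattern z' (s + 8 + int 0 + 1)"
    by (rule run'[where l = "l + 8 * ?q" and t = 1, OF perB]) (use s in \<open>auto simp: algebra_simps\<close>)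
  ultimately show False by (simp add: add.commute)
qed

text \<open>Continuous maps on compact sets of sequences depend on finitely many coordinates: otherwise
  pairs of points agreeing on longer and longer windows would have a common limit.\<close>
lemma continuous_local_rule:
  assumes X: "compact X" and \<phi>: "continuous_on X (\<phi> :: (int \<Rightarrow> int) \<Rightarrow> (int \<Rightarrow> int))"
  shows "\<exists>r::nat. \<forall>x\<in>X. \<forall>x'\<in>X. (\<forall>j. \<bar>j\<bar> \<le> int r \<longrightarrow> x j = x' j) \<longrightarrow> \<phi> x 0 = \<phi> x' 0"
proof (rule ccontr)
  assume "\<not> ?thesis"
  then have "\<forall>r::nat. \<exists>x x'. x \<in> X \<and> x' \<in> X \<and> (\<forall>j. \<bar>j\<bar> \<le> int r \<longrightarrow> x j = x' j) \<and> \<phi> x 0 \<noteq> \<phi> x' 0"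
    by blast
  then obtain x x' where x: "\<And>r::nat. x r \<in> X" "\<And>r. x' r \<in> X"
    "\<And>r j. \<bar>j\<bar> \<le> int r \<Longrightarrow> x r j = x' r j" "\<And>r. \<phi> (x r) 0 \<noteq> \<phi> (x' r) 0" by metis
  obtain l f where l: "l \<in> X" "strict_mono (f::nat\<Rightarrow>nat)" "(x \<circ> f) \<longlonglongrightarrow> l"
    using compact_imp_seq_compact[OF X] x(1) unfolding seq_compact_def by metis
  have "(x' \<circ> f) \<longlonglongrightarrow> l" unfolding tendsto_fun_int_iff
  proof
    fix i
    have "\<forall>\<^sub>F n in sequentially. x' (f n) i = x (f n) i"
    proof (rule eventually_sequentiallyI[of "nat \<bar>i\<bar>"])
      fix n assume "nat \<bar>i\<bar> \<le> n"
      then have "\<bar>i\<bar> \<le> int (f n)" using seq_suble[OF l(2), of n] by linarith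
      then show "x' (f n) i = x (f n) i" using x(3) by metis
    qed
    moreover have "\<forall>\<^sub>F n in sequentially. (x \<circ> f) n i = l i"
      using l(3) unfolding tendsto_fun_int_iff by blast
    ultimately show "\<forall>\<^sub>F n in sequentially. (x' \<circ> f) n i = l i"
      by eventually_elim simp
  qed
  then have "(\<lambda>n. \<phi> ((x' \<circ> f) n)) \<longlonglongrightarrow> \<phi> l"
    by (rule continuous_on_tendsto_compose[OF \<phi> _ l(1)]) (simp add: x)
  then have 1: "\<forall>\<^sub>F n in sequentially. \<phi> ((x' \<circ> f) n) 0 = \<phi> l 0"
    unfolding tendsto_fun_int_iff by blast
  have "(\<lambda>n. \<phi> ((x \<circ> f) n)) \<longlonglongrightarrow> \<phi> l"
    using l(3) by (rule continuous_on_tendsto_compose[OF \<phi> _ l(1)]) (simp add: x)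
  then have "\<forall>\<^sub>F n in sequentially. \<phi> ((x \<circ> f) n) 0 = \<phi> l 0"
    unfolding tendsto_fun_int_iff by blast
  with 1 have "\<forall>\<^sub>F n in sequentially. False" by eventually_elim (metis comp_apply x(4))
  then show False by simp
qed

text \<open>As \<open>\<phi>\<close> turns shifts into inverse shifts, the rule for its coordinate 0 gives one for all
  coordinates, with the window reflected.\<close>
lemma not_conjugate_inverse:
  assumes P: "refining_chain P" and X: "subshift X" "X \<noteq> {}" and sub: "\<And>k. X \<subseteq> coded (P k)"
  shows "\<not> conjugate X shift X (inv shift)"
proof
  assume "conjugate X shift X (inv shift)"
  then obtain \<phi> \<psi> where hom: "homeomorphism X X \<phi> \<psi>" 
    and comm: "\<And>x. x \<in> X \<Longrightarrow> \<phi> (shift x) = inv shift (\<phi> x)"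
    unfolding conjugate_def by blast
  have tr: "(\<lambda>i. x (i + k)) \<in> X" if "x \<in> X" for x k
    using X(1) that by (simp add: subshift_def subshift_shift_int)
  have rev: "\<phi> (\<lambda>i. x (i + k)) = (\<lambda>i. \<phi> x (i - k))" if x: "x \<in> X" for x k
  proof (induction k rule: int_induct[where k = 0])
    case (step1 k)
    then show ?case using comm[OF tr[OF x, of k]]
      by (simp add: inv_shift shift_def algebra_simps)
  next
    case (step2 k)
    have "\<phi> (\<lambda>i. x (i + k)) = (\<lambda>i. \<phi> (\<lambda>i. x (i + (k - 1))) (i - 1))"
      using comm[OF tr[OF x, of "k - 1"]] by (simp add: inv_shift shift_def algebra_simps)
    then have "\<phi> (\<lambda>i. x (i + (k - 1))) (i - 1) = \<phi> x (i - k)" for i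
      using step2.IH by metis
    from this[of "i + 1" for i] show ?case by (auto simp: algebra_simps)
  qed simp
  obtain r :: nat where r: "\<And>x x'. x \<in> X \<Longrightarrow> x' \<in> X \<Longrightarrow> (\<And>j. \<bar>j\<bar> \<le> int r \<Longrightarrow> x j = x' j) \<Longrightarrow> \<phi> x 0 = \<phi> x' 0"
    using continuous_local_rule[OF compact_subshift[OF X(1)], of \<phi>] hom
    unfolding homeomorphism_def by metis
  obtain x where x: "x \<in> X" using X(2) by blast
  then have "\<phi> x \<in> X" using hom by (auto simp: homeomorphism_def)
  show False
  proof (rule no_local_reversal[OF chain_good[OF P]])
    show "x \<in> coded (P (2 * r))" "\<phi> x \<in> coded (P (2 * r))" using x \<open>\<phi> x \<in> X\<close> sub by auto
    show "2 * int r \<le> int (plen (P (2 * r)))" using chain_plen[OF P, of "2 * r"] by simp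
    fix i i' assume a: "\<And>j. \<bar>j\<bar> \<le> int r \<Longrightarrow> x (j - i) = x (j - i')"
    have "\<phi> (\<lambda>j. x (j + - i)) 0 = \<phi> (\<lambda>j. x (j + - i')) 0"
      by (rule r[OF tr[OF x] tr[OF x]]) (use a in simp)
    then show "\<phi> x i = \<phi> x i'" unfolding rev[OF x] by simp
  qed
qed

section \<open>The limit is a strong Toeplitz subshift\<close>

lemma long_word_refine:
  "long_word (subst_word (long_word p) (fst e), subst_word (long_word p) (snd e)) a
    = subst_word (long_word p) (long_word e a)"
proof -
  have "pair_word (subst_word (long_word p) (fst e), subst_word (long_word p) (snd e))
      = (\<lambda>a. subst_word (long_word p) (pair_word e a))"
    by (auto simp: pair_word_def)
  then show ?thesis
    unfolding long_word_def[of _ a] by (simp add: subst_word_subst_word)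
qed

lemma set_long_word: "set (long_word p a) = set (fst p) \<union> set (snd p)"
  by (simp add: long_word_def set_subst_word)

lemma good_binary_letters:
  assumes "good e" "set (fst e) \<subseteq> {0, 1}" "set (snd e) \<subseteq> {0, 1}"
  shows "set (fst e) \<union> set (snd e) = {0, 1}"
proof (rule ccontr)
  assume "\<not> ?thesis"
  then obtain d where d: "d \<in> {0, 1}" "d \<notin> set (fst e)" "d \<notin> set (snd e)" using assms(2,3) by blast
  define c where "c = 1 - d"
  have c: "a = c" if "a \<in> set (fst e) \<union> set (snd e)" for a
  proof -
    have "a \<in> {0, 1}" "a \<noteq> d" using that assms(2,3) d(2,3) by blast+
    then show ?thesis using d(1) by (auto simp: c_def)
  qed
  have "fst e = replicate (length (fst e)) c" "snd e = replicate (length (snd e)) c"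
    using c by (auto intro!: replicate_eqI)
  then show False using assms(1) unfolding good_def by metis
qed

lemma pattern_factor:
  assumes "a \<in> {0, 1}" "b \<in> {0, 1}"
  shows "\<exists>us vs. pattern 0 = us @ [a, b] @ vs"
proof -
  have "pattern 0 = [] @ [0, 0] @ drop 2 (pattern 0)" "pattern 0 = take 3 (pattern 0) @ [0, 1] @ drop 5 (pattern 0)"
    "pattern 0 = take 4 (pattern 0) @ [1, 0] @ drop 6 (pattern 0)" "pattern 0 = take 18 (pattern 0) @ [1, 1] @ []"
    by (simp_all add: pattern_def head_pattern_def)
  then show ?thesis using assms by blast
qed

text \<open>This is where the pattern has to contain all four pairs of letters.\<close>
lemma pair_lang_sublist:
  assumes "w \<in> pair_lang p n"
  shows "sublist w (long_word p 0)"
proof -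
  obtain a b j where w: "w = take n (drop j (pair_word p a @ pair_word p b))" "a \<in> {0, 1}" "b \<in> {0, 1}"
    using assms by (auto simp: pair_lang_def)
  obtain us vs where "pattern 0 = us @ [a, b] @ vs" using pattern_factor[OF w(2,3)] by blast
  then have "sublist (pair_word p a @ pair_word p b) (long_word p 0)"
    unfolding long_word_def sublist_def
    by (intro exI[of _ "subst_word (pair_word p) us"] exI[of _ "subst_word (pair_word p) vs"]) simp
  moreover have "sublist w (pair_word p a @ pair_word p b)"
    unfolding w(1) by (meson sublist_drop sublist_order.order.trans sublist_take)
  ultimately show ?thesis by (rule sublist_order.order.trans[rotated])
qed

lemma sublist_word:
  assumes "sublist u (word y i n)" shows "\<exists>j. u = word y j (length u)"
proof -
  obtain ps ss where d: "word y i n = ps @ u @ ss" using assms by (auto simp: sublist_def)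
  then have "length ps + length u \<le> n" using length_word[of y i n] by simp
  then have "word y (i + int (length ps)) (length u) = take (length u) (drop (length ps) (word y i n))"
    by (rule take_drop_word[symmetric])
  also have "\<dots> = u" unfolding d by simp
  finally show ?thesis by metis
qed

lemma tau_comp_Suc: "n \<le> N \<Longrightarrow> tau_comp \<tau> n (Suc N) w = tau_comp \<tau> n N (\<tau> N w)"
proof -
  have "foldr (\<circ>) fs f w = foldr (\<circ>) fs id (f w)" for fs and f :: "int list \<Rightarrow> int list"
    by (induction fs) auto
  then show "n \<le> N \<Longrightarrow> ?thesis" by (simp add: tau_comp_def)
qed

lemma tau_comp_same: "tau_comp \<tau> n n w = w"
  by (simp add: tau_comp_def)

lemma parses_extend:
  assumes m: "morphism A B (subst_word f)" and y: "y \<in> full_shift A"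
    and L: "\<And>a. a \<in> A \<Longrightarrow> length (f a) = L"
  shows "parses L f 0 y (extend (subst_word f) y)"
  unfolding parses_def
proof
  fix j
  let ?x = "extend (subst_word f) y"
  have len: "length (subst_word f (word y i n)) = n * L" for i n
    using y by (subst length_subst_word[where L = L]) (auto simp: word_def full_shift_def intro: L)
  have nth: "take L (drop (r * L) (subst_word f (word y i n))) = f (y (i + int r))" if "r < n" for i r n
    using y that by (subst subst_word_nth) (auto simp: word_def full_shift_def intro: L)
  show "word ?x (0 + j * int L) L = f (y j)"
  proof (cases "j \<ge> 0")
    case True
    have "word ?x 0 (Suc (nat j) * L) = subst_word f (word y 0 (Suc (nat j)))"
      using extend_right[OF m y, of "Suc (nat j)"] unfolding len .
    then show ?thesis
      using True nth[of "nat j" "Suc (nat j)" 0] take_drop_word[of "nat j * L" L "Suc (nat j) * L" ?x 0] by simp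
  next
    case False
    have "word ?x (- int (nat (- j) * L)) (nat (- j) * L) = subst_word f (word y (- int (nat (- j))) (nat (- j)))"
      using extend_left[OF m y, of "nat (- j)"] unfolding len .
    moreover have "1 * L \<le> nat (- j) * L" using False by (intro mult_le_mono1) linarith
    then have "0 * L + L \<le> nat (- j) * L" by simp
    ultimately show ?thesis
      using False nth[of 0 "nat (- j)" j] take_drop_word[of "0 * L" L "nat (- j) * L" ?x "j * int L"] by simp
  qed
qed

lemma funpow_shift: "(shift ^^ k) x = (\<lambda>i. x (i + int k))"
  by (induction k) (auto simp: shift_def algebra_simps)

text \<open>Recognizability: both parsings start at heads, whose positions are determined modulo the
  length of the long words.\<close>
lemma parses_unique:
  assumes p: "good p" and z: "z \<in> full_shift {0, 1}" and z': "z' \<in> full_shift {0, 1}"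
    and y: "parses (20 * plen p) (long_word p) (- int k) z y"
    and y': "parses (20 * plen p) (long_word p) (- int k') z' y"
    and k: "k < 20 * plen p" "k' < 20 * plen p"
  shows "z = z' \<and> k = k'"
proof -
  let ?M = "int (20 * plen p)"
  have "head_at p y (- int k' + 0 * ?M)" by (rule parses_head_at[OF p y'])
  then obtain t where "- int k' + 0 * ?M = - int k + t * ?M" using head_at_cut[OF p z y] by blast
  then have t: "int k = int k' + t * ?M" by simp
  have "int k mod ?M = int k' mod ?M" unfolding t by simp
  then have kk: "k = k'" using k by simp
  have "z j = z' j" for j
  proof -
    have "long_word p (z j) = long_word p (z' j)"
      using y y' unfolding kk parses_def by metis
    moreover have "z j \<in> {0, 1}" "z' j \<in> {0, 1}" using z z' by (auto simp: full_shift_def)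
    ultimately show ?thesis using inj_long_word[OF p] by blast
  qed
  then show ?thesis using kk by auto
qed

text \<open>The substitution at level \<open>k\<close> maps a letter to a long word of the pair by which the chain
  passes from level \<open>k - 1\<close> to level \<open>k\<close>; at level 0 the initial pair itself takes this place.
  Then \<open>\<tau>\<^sub>0 \<circ> \<dots> \<circ> \<tau>\<^sub>k\<close> maps letters to the long words of \<open>P k\<close>.  Primitivity
  holds within one level, because distinct binary words of the same length together
  contain both letters, and because the alphabet at level 0 consists of the letters of the
  initial pair.\<close>
lemma strong_Toeplitz_chain_limit:
  assumes P: "refining_chain P"
  shows "strong_Toeplitz 2 (chain_limit P)"
proof -
  note good = chain_good[OF P]
  have "\<forall>k. \<exists>e. good e \<and> set (fst e) \<subseteq> {0, 1} \<and> set (snd e) \<subseteq> {0, 1} \<and>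
     P (Suc k) = (subst_word (long_word (P k)) (fst e), subst_word (long_word (P k)) (snd e))"
    using P by (simp add: refining_chain_def pair_refines_def)
  then obtain e where e: "\<And>k. good (e k)" "\<And>k. set (fst (e k)) \<subseteq> {0, 1}" "\<And>k. set (snd (e k)) \<subseteq> {0, 1}"
     "\<And>k. P (Suc k) = (subst_word (long_word (P k)) (fst (e k)), subst_word (long_word (P k)) (snd (e k)))"
    by metis
  define E where "E k = (case k of 0 \<Rightarrow> P 0 | Suc j \<Rightarrow> e j)" for k
  define \<A> where "\<A> k = set (fst (E k)) \<union> set (snd (E k))" for k
  define \<tau> where "\<tau> k = subst_word (long_word (E k))" for k
  have E: "good (E k)" for k using e(1) good by (auto simp: E_def split: nat.split)
  have \<A>: "\<A> (Suc k) = {0, 1}" for k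
    using good_binary_letters[OF e(1-3)] by (simp add: \<A>_def E_def)
  have len: "length (\<tau> k [a]) = 20 * plen (E k)" for k a
    by (simp add: \<tau>_def length_long_word[OF E])
  have comp: "tau_comp \<tau> 0 (Suc k) w = subst_word (long_word (P k)) w" for k w
  proof (induction k arbitrary: w)
    case 0
    show ?case by (subst tau_comp_Suc) (auto simp: tau_comp_same \<tau>_def E_def)
  next
    case (Suc k)
    have "tau_comp \<tau> 0 (Suc (Suc k)) w = subst_word (long_word (P k)) (\<tau> (Suc k) w)"
      using Suc by (subst tau_comp_Suc) auto
    also have "\<dots> = subst_word (long_word (P (Suc k))) w"
      unfolding e(4)[of k] long_word_refine[abs_def] by (simp add: subst_word_subst_word \<tau>_def E_def)
    finally show ?case .
  qed
  have morph: "morphism (\<A> (Suc n)) (\<A> n) (\<tau> n)" for n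
  proof -
    have "long_word (E n) a \<noteq> []" for a
      using length_long_word[OF E, of n a] plen_pos[OF E, of n] by auto
    then show ?thesis
      by (auto simp: morphism_def \<tau>_def \<A>_def lists_eq_set set_subst_word set_long_word)
  qed
  have dir: "directive_sequence \<A> \<tau>"
    using morph by (auto simp: directive_sequence_def \<A>_def)
  have const: "constant_length \<A> \<tau>" by (simp add: constant_length_def len)
  have prim: "primitive \<A> \<tau>" unfolding primitive_def
  proof
    fix n
    have "\<A> n \<subseteq> set (tau_comp \<tau> n (Suc n) [a])" for a
      by (simp add: tau_comp_Suc tau_comp_same \<tau>_def \<A>_def set_long_word)
    then show "\<exists>N>n. \<forall>a\<in>\<A> N. \<A> n \<subseteq> set (tau_comp \<tau> n N [a])" by blast
  qed
  have proper: "proper \<A> \<tau>"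
  proof -
    have ne: "fst (E n) \<noteq> []" "snd (E n) \<noteq> []" for n using E[of n] plen_pos[OF E, of n] by (auto simp: good_def)
    have "hd (\<tau> n [a]) = hd (fst (E n)) \<and> last (\<tau> n [a]) = last (snd (E n))" for n a
      using ne by (auto simp: \<tau>_def long_word_def pattern_def head_pattern_def)
    then show ?thesis by (simp add: proper_def)
  qed
  have rec: "recognizable \<A> \<tau>" unfolding recognizable_def
  proof (intro allI ballI)
    fix n x
    have key: "z \<in> full_shift {0, 1} \<and> k < 20 * plen (E n) \<and>
        parses (20 * plen (E n)) (long_word (E n)) (- int k) z x"
      if h: "z \<in> S_adic_level \<A> \<tau> (Suc n) \<and> k < length (\<tau> n [z 0]) \<and> x = (shift ^^ k) (extend (\<tau> n) z)" for z k
    proof -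
      have z: "z \<in> full_shift (\<A> (Suc n))" using h by (auto simp: S_adic_level_def)
      have "parses (20 * plen (E n)) (long_word (E n)) 0 z (extend (\<tau> n) z)"
        unfolding \<tau>_def by (rule parses_extend[OF _ z]) (use morph[of n] length_long_word[OF E] in \<open>auto simp: \<tau>_def\<close>)
      then have "parses (20 * plen (E n)) (long_word (E n)) (- int k) z x"
        using h by (simp add: parses_def funpow_shift word_translate)
      then show ?thesis using z h by (simp add: \<A> len)
    qed
    show "\<exists>\<^sub>\<le>\<^sub>1 (y, k). y \<in> S_adic_level \<A> \<tau> (Suc n) \<and> k < length (\<tau> n [y 0]) \<and>
        x = (shift ^^ k) (extend (\<tau> n) y)"
      unfolding Uniq_def
    proof (clarify, goal_cases)
      case (1 z k z' k')
      note a = key[of z k] and b = key[of z' k']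
      show ?case using parses_unique[OF E] a b 1 by blast
    qed
  qed
  have rank: "alphabet_rank \<A> \<le> enat 2"
  proof -
    have "\<forall>\<^sub>F n in sequentially. enat (card (\<A> n)) = enat 2"
    proof (rule eventually_sequentiallyI[of 1])
      fix n :: nat assume "1 \<le> n"
      then obtain k where "n = Suc k" by (cases n) auto
      then show "enat (card (\<A> n)) = enat 2" by (simp add: \<A>)
    qed
    then have "alphabet_rank \<A> = liminf (\<lambda>n. enat 2)"
      unfolding alphabet_rank_def by (rule Liminf_eq)
    then show ?thesis by (simp add: Liminf_const)
  qed
  obtain y where y: "y \<in> chain_limit P" using chain_limit_nonempty[OF P] by blast
  have occurs: "\<exists>j. u = word y j (length u)" if a: "a \<in> {0, 1}" "sublist u (long_word (P N) a)" for N a u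
  proof -
    obtain b where b: "b \<in> {0, 1}" "a \<in> set (pair_word (e N) b)"
      using good_binary_letters[OF e(1-3), of N] a(1) by (metis Un_iff insertI1 insertI2 pair_word_simps)
    then obtain us vs where "pair_word (e N) b = us @ a # vs" by (metis split_list)
    moreover have "pair_word (P (Suc N)) b = subst_word (long_word (P N)) (pair_word (e N) b)"
      unfolding e(4) by (auto simp: pair_word_def)
    ultimately have "sublist (long_word (P N) a) (pair_word (P (Suc N)) b)" by simp
    moreover have "pair_word (P (Suc N)) b \<in> pair_lang (P (Suc N)) (plen (P (Suc N)))"
      unfolding pair_lang_def using b length_pair_word[OF good, of "Suc N" b]
      by (intro CollectI exI[of _ b] exI[of _ 0]) simp
    then obtain i where "pair_word (P (Suc N)) b = word y i (plen (P (Suc N)))"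
      using words_coded[OF good, of y "Suc N" "plen (P (Suc N))"] y unfolding chain_limit_def by blast
    ultimately have "sublist u (word y i (plen (P (Suc N))))"
      using a(2) by (metis sublist_order.order.trans)
    then show ?thesis by (rule sublist_word)
  qed
  have "S_adic \<A> \<tau> = chain_limit P"
  proof (intro equalityI subsetI)
    fix x assume x: "x \<in> chain_limit P"
    then have xk: "x \<in> coded (P k)" for k by (simp add: chain_limit_def)
    have "x \<in> full_shift (\<A> 0)"
      using xk[of 0] coded_subset_full_shift[OF good, of 0] by (auto simp: \<A>_def E_def)
    moreover have "\<exists>N>0. \<exists>a\<in>\<A> N. sublist (word x i m) (tau_comp \<tau> 0 N [a])" for i m
    proof -
      have "word x i m \<in> pair_lang (P m) m"
        using words_coded[OF good xk, of m m] chain_plen[OF P, of m] by auto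
      then have "sublist (word x i m) (tau_comp \<tau> 0 (Suc m) [0])"
        unfolding comp using pair_lang_sublist by simp
      then show ?thesis using \<A>[of m] by blast
    qed
    ultimately show "x \<in> S_adic \<A> \<tau>" by (simp add: S_adic_level_def)
  next
    fix x assume x: "x \<in> S_adic \<A> \<tau>"
    have "x \<in> coded (P k)" for k
    proof (rule coded_local[OF good])
      fix i
      let ?u = "word x i (40 * plen (P k))"
      obtain N a where N: "N > 0" "a \<in> \<A> N" "sublist ?u (tau_comp \<tau> 0 N [a])"
        using x unfolding S_adic_level_def by blast
      then obtain M where M: "N = Suc M" by (cases N) auto
      obtain j where "?u = word y j (length ?u)"
        using occurs[of a ?u M] N unfolding M comp \<A> by auto
      then show "?u \<in> lang (40 * plen (P k)) (coded (P k))"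
        using y unfolding chain_limit_def lang_def length_word by blast
    qed
    then show "x \<in> chain_limit P" by (simp add: chain_limit_def)
  qed
  moreover have "conjugate (chain_limit P) shift (chain_limit P) shift"
    unfolding conjugate_def using homeomorphism_ident[of "chain_limit P"] by blast
  moreover have "subshift (chain_limit P)"
    using chain_limit_infinite_minimal[OF P] by (simp add: infinite_minimal_subshifts_def)
  ultimately show ?thesis
    unfolding strong_Toeplitz_def using dir const prim proper rec rank by metis
qed

section \<open>Approximation\<close>

text \<open>A loop at \<open>w\<close> is a word \<open>t\<close> such that \<open>t w\<close> starts with \<open>w\<close>.  Whatever loops follow
  \<open>t\<close>, the next \<open>n\<close> letters are those of \<open>w\<close>; so every window of length \<open>n\<close> in a
  concatenation of loops is a window of some \<open>t w\<close>.\<close>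
lemma windows_of_loops:
  fixes w :: "int list"
  assumes "\<And>t. t \<in> set ts \<Longrightarrow> take n (t @ w) = w"
    and "\<And>t j. t \<in> set ts \<Longrightarrow> j \<le> length t \<Longrightarrow> take n (drop j (t @ w)) \<in> L"
    and "length w = n" "w \<in> L"
  shows "take n (concat ts @ w) = w \<and> (\<forall>j\<le>length (concat ts). take n (drop j (concat ts @ w)) \<in> L)"
  using assms(1,2)
proof (induction ts)
  case Nil
  then show ?case using assms(3,4) by simp
next
  case (Cons t ts)
  let ?R = "concat ts @ w"
  have IH: "take n ?R = w" "\<And>j. j \<le> length (concat ts) \<Longrightarrow> take n (drop j ?R) \<in> L"
    using Cons.IH Cons.prems by auto
  have step: "take n (drop j (t @ ?R)) = take n (drop j (t @ w))" if "j \<le> length t" for j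
  proof -
    have "take n (u @ v) = take n (u @ take n v)" for u v :: "int list" by (simp add: min_def)
    then have "take n (drop j t @ ?R) = take n (drop j t @ take n ?R)" .
    then show ?thesis using that unfolding IH(1) by simp
  qed
  have "take n (drop j (t @ ?R)) \<in> L" if "j \<le> length (concat (t # ts))" for j
  proof (cases "j \<le> length t")
    case True
    then show ?thesis using step[OF True] Cons.prems(2)[of t j] by simp
  next
    case False
    then show ?thesis using IH(2)[of "j - length t"] that by simp
  qed
  moreover have "take n (t @ ?R) = w" using step[of 0] Cons.prems(1)[of t] by simp
  ultimately show ?case by simp
qed

text \<open>By pigeonhole some word \<open>w\<close> of length \<open>n\<close> occurs at infinitely many multiples of \<open>M\<close>.
  Fix two of them, \<open>a M\<close> and \<open>b M\<close>, far enough apart to see all words of \<open>Y\<close> in between, and let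
  \<open>\<alpha>\<close> be the word between them.  If the word \<open>\<beta>\<close> from \<open>b M\<close> to each later occurrence
  \<open>c M\<close> commuted with \<open>\<alpha>\<close>, the point would have period \<open>|\<alpha>|\<close> to the right of \<open>a M\<close>.\<close>
lemma noncommuting_return_words:
  assumes Y: "Y \<in> infinite_minimal_subshifts" and y: "y \<in> Y" and M: "M > 0"
  shows "\<exists>a b c. a < b \<and> b < c \<and> word y (int (a * M)) n = word y (int (b * M)) n
    \<and> word y (int (b * M)) n = word y (int (c * M)) n
    \<and> (\<forall>u\<in>lang n Y. \<exists>i\<ge>int (a * M). i + int n \<le> int (b * M) \<and> word y i n = u)
    \<and> word y (int (a * M)) ((b - a) * M) @ word y (int (b * M)) ((c - b) * M)
      \<noteq> word y (int (b * M)) ((c - b) * M) @ word y (int (a * M)) ((b - a) * M)"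
proof -
  have sub: "subshift Y" and mini: "minimal Y"
    using Y by (auto simp: infinite_minimal_subshifts_def)
  let ?w = "\<lambda>j. word y (int (j * M)) n"
  have "finite (range ?w)"
    by (rule finite_subset[OF _ finite_lang[OF sub, of n]]) (use y in \<open>auto simp: lang_def\<close>)
  then obtain a where J: "infinite {j. ?w j = ?w a}"
    using pigeonhole_infinite[of "UNIV :: nat set" ?w] by auto
  have later: "\<exists>j>m. ?w j = ?w a" for m
    using J unfolding infinite_nat_iff_unbounded by blast
  have "\<forall>u\<in>lang n Y. \<exists>i\<ge>int (a * M). word y i n = u"
    using minimal_recurrence[OF sub mini y] by blast
  then obtain pos where pos: "\<And>u. u \<in> lang n Y \<Longrightarrow> pos u \<ge> int (a * M) \<and> word y (pos u) n = u"
    by metis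
  \<comment> \<open>0 only keeps the set nonempty\<close>
  define m where "m = Max (insert 0 (pos ` lang n Y))"
  have posm: "pos u \<le> m" if "u \<in> lang n Y" for u
    unfolding m_def using that finite_lang[OF sub, of n] by (intro Max_ge) auto
  have big: "j \<le> j * M" for j using M by simp
  obtain b where b: "b > a + nat m + n" "?w b = ?w a" using later by blast
  have cover: "\<exists>i\<ge>int (a * M). i + int n \<le> int (b * M) \<and> word y i n = u" if "u \<in> lang n Y" for u
    using pos[OF that] posm[OF that] b(1) big[of b] by (intro exI[of _ "pos u"]) linarith
  define t where "t = (b - a) * M"
  have "t > 0" using b(1) M by (simp add: t_def)
  then obtain i where i: "i \<ge> int (a * M)" "y (i + int t) \<noteq> y i"
    using infinite_minimal_not_eventually_periodic[OF Y y] by blast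
  obtain c where c: "c > b + nat i + t" "?w c = ?w a" using later by blast
  let ?\<alpha> = "word y (int (a * M)) ((b - a) * M)" and ?\<beta> = "word y (int (b * M)) ((c - b) * M)"
  have "?\<alpha> @ ?\<beta> \<noteq> ?\<beta> @ ?\<alpha>"
  proof
    assume eq: "?\<alpha> @ ?\<beta> = ?\<beta> @ ?\<alpha>"
    define k where "k = nat (i - int (a * M))"
    have bt: "int (b * M) = int (a * M) + int t" using b(1) by (simp add: t_def diff_mult_distrib)
    have ct: "int ((c - b) * M) = int (c * M) - int (b * M)"
      using c(1) by (simp add: diff_mult_distrib algebra_simps of_nat_diff)
    have k: "k < (c - b) * M"
      using c(1) big[of c] i(1) bt ct unfolding k_def by linarith
    have "?\<beta> ! k = (?\<alpha> @ ?\<beta>) ! (t + k)" by (simp add: nth_append t_def)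
    also have "\<dots> = (?\<beta> @ ?\<alpha>) ! (t + k)" using eq by simp
    finally have "(?\<alpha> @ ?\<beta>) ! k = ?\<beta> ! k" using eq k by (simp add: nth_append)
    moreover have "?\<alpha> @ ?\<beta> = word y (int (a * M)) (t + (c - b) * M)"
      using word_append[of y "int (a * M)" t "(c - b) * M"] bt by (simp add: t_def)
    ultimately have "y (int (a * M) + int k) = y (int (b * M) + int k)" using k by simp
    moreover have "int (a * M) + int k = i" using i(1) by (simp add: k_def)
    moreover from this have "int (b * M) + int k = i + int t" using bt by linarith
    ultimately show False using i(2) by metis
  qed
  then show ?thesis using b c cover by (intro exI[of _ a] exI[of _ b] exI[of _ c]) auto
qed

text \<open>The words \<open>\<alpha>\<close>, \<open>\<beta>\<close> lead from one occurrence of \<open>w\<close> to another, so their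
  concatenations contain no new words of length \<open>n\<close>; and \<open>\<alpha>\<close> alone contains all those of \<open>Y\<close>.\<close>
lemma approximating_pair:
  assumes Y: "Y \<in> infinite_minimal_subshifts" and y: "y \<in> Y" and M: "M > 0"
  shows "\<exists>a b c. a < b \<and> b < c \<and>
    (let \<alpha> = word y (int (a * M)) ((b - a) * M); \<beta> = word y (int (b * M)) ((c - b) * M);
         p = (\<alpha> @ \<beta>, \<beta> @ \<alpha>) in good p \<and> n \<le> plen p \<and> pair_lang p n = lang n Y)"
proof -
  obtain a b c where abc: "a < b" "b < c" 
    and wb: "word y (int (b * M)) n = word y (int (a * M)) n"
    and wc: "word y (int (c * M)) n = word y (int (a * M)) n"
    and cover: "\<And>u. u \<in> lang n Y \<Longrightarrow> \<exists>i\<ge>int (a * M). i + int n \<le> int (b * M) \<and> word y i n = u"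
    and ne: "word y (int (a * M)) ((b - a) * M) @ word y (int (b * M)) ((c - b) * M)
      \<noteq> word y (int (b * M)) ((c - b) * M) @ word y (int (a * M)) ((b - a) * M)"
    using noncommuting_return_words[OF Y y M, of n] by metis
  define w where "w = word y (int (a * M)) n"
  define \<alpha> \<beta> where "\<alpha> = word y (int (a * M)) ((b - a) * M)" and "\<beta> = word y (int (b * M)) ((c - b) * M)"
  define p where "p = (\<alpha> @ \<beta>, \<beta> @ \<alpha>)"
  have p: "good p" using ne by (simp add: good_def p_def \<alpha>_def \<beta>_def)
  have in_lang: "word y i n \<in> lang n Y" for i using y by (auto simp: lang_def)
  have next_return: "int (b * M) = int (a * M) + int ((b - a) * M)" if "a < b" for a b
    using that by (simp add: diff_mult_distrib)
  have \<alpha>w: "\<alpha> @ w = word y (int (a * M)) ((b - a) * M + n)"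
    unfolding \<alpha>_def w_def word_append next_return[OF abc(1), symmetric] wb ..
  have \<beta>w: "\<beta> @ w = word y (int (b * M)) ((c - b) * M + n)"
    unfolding \<beta>_def w_def word_append next_return[OF abc(2), symmetric] wc ..
  have len: "length \<alpha> = (b - a) * M" "length \<beta> = (c - b) * M" by (simp_all add: \<alpha>_def \<beta>_def)
  have loop: "take n (t @ w) = w" "j \<le> length t \<Longrightarrow> take n (drop j (t @ w)) \<in> lang n Y"
    if "t \<in> {\<alpha>, \<beta>}" for t j
  proof -
    have "\<exists>i. t @ w = word y i (length t + n) \<and> word y i n = w"
    proof (cases "t = \<alpha>")
      case True
      then show ?thesis using \<alpha>w unfolding True len w_def by blast
    next
      case False
      then have t: "t = \<beta>" using that by blast
      show ?thesis using \<beta>w wb unfolding t len w_def by blast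
    qed
    then obtain i where i: "t @ w = word y i (length t + n)" "word y i n = w" by blast
    show "take n (t @ w) = w" using take_drop_word[of 0 n "length t + n" y i] i by simp
    show "j \<le> length t \<Longrightarrow> take n (drop j (t @ w)) \<in> lang n Y"
      unfolding i(1) using in_lang by (simp add: take_drop_word)
  qed
  obtain u where u: "u \<in> lang n Y" using in_lang by blast
  obtain i where "i \<ge> int (a * M)" "i + int n \<le> int (b * M)" using cover[OF u] by blast
  then have "int n \<le> int ((b - a) * M)" unfolding next_return[OF abc(1)] by linarith
  then have n\<alpha>: "n \<le> length \<alpha>" unfolding len of_nat_le_iff .
  have "pair_lang p n = lang n Y"
  proof (intro equalityI subsetI)
    fix v assume "v \<in> pair_lang p n"
    then obtain d e j where v: "v = take n (drop j (pair_word p d @ pair_word p e))"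
      "j + n \<le> 2 * plen p" by (auto simp: pair_lang_def)
    have "\<exists>ts. set ts \<subseteq> {\<alpha>, \<beta>} \<and> pair_word p f = concat ts" for f
      by (cases "f = 0"; rule exI[of _ "if f = 0 then [\<alpha>, \<beta>] else [\<beta>, \<alpha>]"]) (auto simp: pair_word_def p_def)
    then obtain ts ts' where "set ts \<subseteq> {\<alpha>, \<beta>}" "pair_word p d = concat ts"
      "set ts' \<subseteq> {\<alpha>, \<beta>}" "pair_word p e = concat ts'" by metis
    then have ts: "set (ts @ ts') \<subseteq> {\<alpha>, \<beta>}" "pair_word p d @ pair_word p e = concat (ts @ ts')" by auto
    have l: "length (concat (ts @ ts')) = 2 * plen p"
      unfolding ts(2)[symmetric] by (simp add: length_pair_word[OF p])
    have "v = take n (drop j (concat (ts @ ts') @ w))" using v l unfolding ts(2) by simp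
    moreover have "\<forall>j\<le>length (concat (ts @ ts')). take n (drop j (concat (ts @ ts') @ w)) \<in> lang n Y"
      by (rule conjunct2, rule windows_of_loops)
        (use loop ts(1) in_lang in \<open>auto simp: w_def\<close>)
    moreover have "j \<le> length (concat (ts @ ts'))" using v(2) unfolding l by linarith
    ultimately show "v \<in> lang n Y" by metis
  next
    fix v assume "v \<in> lang n Y"
    then obtain i where i: "i \<ge> int (a * M)" "i + int n \<le> int (b * M)" "word y i n = v"
      using cover by blast
    define j where "j = nat (i - int (a * M))"
    have j: "i = int (a * M) + int j" using i(1) by (simp add: j_def)
    have jn: "j + n \<le> (b - a) * M" using i(2) unfolding next_return[OF abc(1)] j by linarith
    then have "v = take n (drop j \<alpha>)" using i(3) unfolding \<alpha>_def take_drop_word[OF jn] j by simp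
    then have "v = take n (drop j (pair_word p 0 @ pair_word p 0))" using jn len by (simp add: p_def)
    moreover have "j + n \<le> 2 * plen p" using jn len by (simp add: p_def)
    ultimately show "v \<in> pair_lang p n" unfolding pair_lang_def by blast
  qed
  then show ?thesis using p n\<alpha> abc
    by (intro exI[of _ a] exI[of _ b] exI[of _ c]) (simp add: Let_def p_def \<alpha>_def \<beta>_def)
qed

lemma approximating_good_pair:
  assumes Y: "Y \<in> infinite_minimal_subshifts"
  shows "\<exists>p. good p \<and> n \<le> plen p \<and> pair_lang p n = lang n Y"
proof -
  have "Y \<noteq> {}" using Y by (auto simp: infinite_minimal_subshifts_def)
  then obtain y where "y \<in> Y" by blast
  from approximating_pair[OF Y this zero_less_one, of n] show ?thesis unfolding Let_def by blast
qed

text \<open>Return words are cut at multiples of the length of the long words, counted from a cut of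
  the parsing.\<close>
lemma approximating_refinement:
  assumes Y: "Y \<in> infinite_minimal_subshifts" and p: "good p" and sub: "Y \<subseteq> coded p"
  shows "\<exists>p'. pair_refines p p' \<and> n \<le> plen p' \<and> pair_lang p' n = lang n Y"
proof -
  have "Y \<noteq> {}" using Y by (auto simp: infinite_minimal_subshifts_def)
  then obtain y g z where y: "y \<in> Y" and z: "z \<in> full_shift {0, 1}"
    and gz: "parses (20 * plen p) (long_word p) g z y" using sub by (fastforce simp: coded_def)
  let ?y = "\<lambda>i. y (i + g)" and ?M = "20 * plen p"
  have y0: "?y \<in> Y"
    using Y y by (auto simp: infinite_minimal_subshifts_def subshift_def subshift_shift_int)
  have parse: "parses ?M (long_word p) 0 z ?y"
    using gz by (simp add: parses_def word_translate add.commute)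
  have M: "?M > 0" using plen_pos[OF p] by simp
  have blocks: "word ?y (int (a * ?M)) ((b - a) * ?M) = subst_word (long_word p) (word z (int a) (b - a))" for a b
    using parses_word[OF parse, of "int a" "b - a"] by simp
  obtain a b c where H: "let \<alpha> = word ?y (int (a * ?M)) ((b - a) * ?M);
      \<beta> = word ?y (int (b * ?M)) ((c - b) * ?M); p = (\<alpha> @ \<beta>, \<beta> @ \<alpha>)
    in good p \<and> n \<le> plen p \<and> pair_lang p n = lang n Y"
    using approximating_pair[OF Y y0 M, of n] by blast
  define \<xi> \<eta> where "\<xi> = word z (int a) (b - a)" and "\<eta> = word z (int b) (c - b)"
  define p' where "p' = (subst_word (long_word p) (\<xi> @ \<eta>), subst_word (long_word p) (\<eta> @ \<xi>))"
  have p': "good p'" "n \<le> plen p'" "pair_lang p' n = lang n Y"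
    using H unfolding Let_def blocks p'_def \<xi>_def[symmetric] \<eta>_def[symmetric] subst_word_simps by blast+
  have "\<xi> @ \<eta> \<noteq> \<eta> @ \<xi>"
    using p'(1) unfolding p'_def good_def fst_conv snd_conv by (metis (no_types))
  then have "good (\<xi> @ \<eta>, \<eta> @ \<xi>)" by (simp add: good_def)
  moreover have "set \<xi> \<subseteq> {0, 1}" "set \<eta> \<subseteq> {0, 1}"
    using word_in_lists[OF z] by (auto simp: lists_eq_set \<xi>_def \<eta>_def)
  ultimately have "pair_refines p p'" unfolding pair_refines_def p'_def by (intro exI[of _ "(\<xi> @ \<eta>, \<eta> @ \<xi>)"]) auto
  then show ?thesis using p' by blast
qed

text \<open>The limit of the chain in which each pair consists of the long words of the previous one.\<close>
lemma exists_infinite_minimal_coded: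
  assumes p: "good p" shows "\<exists>X\<in>infinite_minimal_subshifts. X \<subseteq> coded p"
proof -
  define P where "P = rec_nat p (\<lambda>_ q. (subst_word (long_word q) [0], subst_word (long_word q) [1]))"
  have "pair_refines (P k) (P (Suc k))" for k
    unfolding pair_refines_def P_def by (intro exI[of _ "([0], [1])"]) (simp add: good_def)
  then have "refining_chain P" using p by (simp add: refining_chain_def P_def)
  then have "chain_limit P \<in> infinite_minimal_subshifts" by (rule chain_limit_infinite_minimal)
  moreover have "chain_limit P \<subseteq> coded (P 0)" by (auto simp: chain_limit_def)
  ultimately show ?thesis by (auto simp: P_def)
qed

section \<open>A generic set of subshifts with a refining chain\<close>

text \<open>Equivalent to \<open>Y \<subseteq> coded p\<close> for good pairs, but phrased in terms of a single word length,
  so that it is visibly locally constant in \<open>Y\<close>.\<close>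
definition coded_by :: "word_pair \<Rightarrow> (int \<Rightarrow> int) set \<Rightarrow> bool" where
  "coded_by p Y \<longleftrightarrow> lang (40 * plen p) Y \<subseteq> lang (40 * plen p) (coded p)"

lemma coded_by_iff:
  assumes p: "good p"
  shows "coded_by p Y \<longleftrightarrow> Y \<subseteq> coded p"
proof
  assume c: "coded_by p Y"
  show "Y \<subseteq> coded p"
  proof
    fix y assume "y \<in> Y"
    then have "word y i (40 * plen p) \<in> lang (40 * plen p) Y" for i by (auto simp: lang_def)
    then show "y \<in> coded p" using c unfolding coded_by_def by (intro coded_local[OF p]) blast
  qed
qed (auto simp: coded_by_def lang_def)

text \<open>\<^const>\<open>None\<close> stands for the stage before the first pair is selected.\<close>
definition extends :: "word_pair option \<Rightarrow> word_pair \<Rightarrow> bool" where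
  "extends s p \<longleftrightarrow> (case s of None \<Rightarrow> good p | Some p' \<Rightarrow> pair_refines p' p)"

text \<open>The selection takes the first suitable pair in an enumeration of all pairs; its value is
  meaningful as long as \<open>staged\<close>, defined next, holds.\<close>
primrec stage :: "(int \<Rightarrow> int) set \<Rightarrow> nat \<Rightarrow> word_pair option" where
  "stage Y 0 = None"
| "stage Y (Suc k) = Some (from_nat (LEAST m. extends (stage Y k) (from_nat m) \<and> coded_by (from_nat m) Y))"

definition staged :: "(int \<Rightarrow> int) set \<Rightarrow> nat \<Rightarrow> bool" where
  "staged Y k \<longleftrightarrow> (\<forall>j<k. \<exists>p. extends (stage Y j) p \<and> coded_by p Y)"

lemma staged_Suc:
  "staged Y (Suc k) \<longleftrightarrow> staged Y k \<and> (\<exists>p. extends (stage Y k) p \<and> coded_by p Y)"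
  by (auto simp: staged_def less_Suc_eq)

lemma stage_SucE:
  assumes "staged Y (Suc k)"
  obtains p where "stage Y (Suc k) = Some p" "extends (stage Y k) p" "coded_by p Y"
proof -
  let ?Q = "\<lambda>m. extends (stage Y k) (from_nat m) \<and> coded_by (from_nat m) Y"
  obtain p where "extends (stage Y k) p \<and> coded_by p Y" using assms staged_Suc by blast
  then have "?Q (to_nat p)" by simp
  then have "?Q (LEAST m. ?Q m)" by (rule LeastI)
  then show ?thesis using that by simp
qed

lemma stage_good:
  assumes "staged Y k" "stage Y k = Some p"
  shows "good p \<and> Y \<subseteq> coded p"
  using assms
proof (induction k arbitrary: p)
  case (Suc k)
  obtain p' where p': "stage Y (Suc k) = Some p'" "extends (stage Y k) p'" "coded_by p' Y"
    using Suc.prems(1) by (rule stage_SucE)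
  have pp: "p' = p" using p'(1) Suc.prems(2) by (metis option.inject)
  have "good p"
  proof (cases "stage Y k")
    case None
    then show ?thesis using p'(2) by (simp add: extends_def pp)
  next
    case (Some q)
    then have "good q" "pair_refines q p"
      using p'(2) Suc.IH[OF _ Some] Suc.prems(1) by (auto simp: extends_def pp staged_Suc)
    then show ?thesis by (rule refines_good(1))
  qed
  then show ?case using p'(3) coded_by_iff pp by blast
qed simp

text \<open>Selecting the pair with code \<open>L\<close> only involves the conditions \<open>coded_by\<close> for codes up
  to \<open>L\<close>, which are determined by finitely many word lengths.\<close>
lemma stage_locally_constant:
  assumes "staged Y k"
  shows "\<exists>n. \<forall>Y'. lang n Y' = lang n Y \<longrightarrow> staged Y' k \<and> (\<forall>j\<le>k. stage Y' j = stage Y j)"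
  using assms
proof (induction k)
  case 0
  then show ?case by (simp add: staged_def)
next
  case (Suc k)
  let ?Q = "\<lambda>Y m. extends (stage Y k) (from_nat m) \<and> coded_by (from_nat m) Y"
  define L where "L = (LEAST m. ?Q Y m)"
  obtain p where "extends (stage Y k) p \<and> coded_by p Y" using Suc.prems staged_Suc by blast
  then have "?Q Y (to_nat p)" by simp
  then have L: "?Q Y L" unfolding L_def by (rule LeastI)
  have less: "\<not> ?Q Y m" if "m < L" for m using that not_less_Least unfolding L_def by blast
  obtain n where n: "\<And>Y'. lang n Y' = lang n Y \<Longrightarrow> staged Y' k \<and> (\<forall>j\<le>k. stage Y' j = stage Y j)"
    using Suc.IH Suc.prems staged_Suc by blast
  define N where "N = n + (\<Sum>m\<le>L. 40 * plen (from_nat m))"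
  have "staged Y' (Suc k) \<and> (\<forall>j\<le>Suc k. stage Y' j = stage Y j)" if eq: "lang N Y' = lang N Y" for Y'
  proof -
    have "lang n Y' = lang n Y" by (rule lang_eq_mono[OF eq]) (simp add: N_def)
    from n[OF this] have k: "staged Y' k" "\<And>j. j \<le> k \<Longrightarrow> stage Y' j = stage Y j" by blast+
    have same: "?Q Y' m \<longleftrightarrow> ?Q Y m" if "m \<le> L" for m
    proof -
      have "40 * plen (from_nat m) \<le> (\<Sum>m\<le>L. 40 * plen (from_nat m))"
        using that by (intro member_le_sum) auto
      then have "lang (40 * plen (from_nat m)) Y' = lang (40 * plen (from_nat m)) Y"
        by (intro lang_eq_mono[OF eq]) (simp add: N_def)
      then show ?thesis using k(2)[of k] unfolding coded_by_def by simp
    qed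
    have L': "?Q Y' L" using same L by blast
    have "(LEAST m. ?Q Y' m) = L"
    proof (rule Least_equality)
      show "?Q Y' L" by (rule L')
      fix m assume "?Q Y' m"
      then show "L \<le> m" using same[of m] less[of m] by (meson linear not_le)
    qed
    then have "stage Y' (Suc k) = stage Y (Suc k)" by (simp add: L_def)
    then show ?thesis
      using k L' unfolding staged_Suc le_Suc_eq by (metis (no_types, lifting))
  qed
  then show ?case by blast
qed

text \<open>The selection for \<open>Y'\<close> need not take \<open>p\<close>; what matters is that it finds some
  pair.\<close>
lemma staged_step_dense:
  assumes Y: "Y \<in> infinite_minimal_subshifts" and s: "staged Y k"
  shows "\<exists>p Y'. Y' \<in> infinite_minimal_subshifts \<and> lang n Y' = lang n Y
    \<and> extends (stage Y k) p \<and> coded_by p Y'"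
proof -
  obtain p where p: "good p" "extends (stage Y k) p" "n \<le> plen p" "pair_lang p n = lang n Y"
  proof (cases "stage Y k")
    case None
    then show ?thesis using approximating_good_pair[OF Y, of n] that by (auto simp: extends_def)
  next
    case (Some q)
    then have "good q" "Y \<subseteq> coded q" using stage_good[OF s] by blast+
    then show ?thesis using approximating_refinement[OF Y, of q n] refines_good(1)[of q] that Some
      by (auto simp: extends_def)
  qed
  obtain Y' where Y': "Y' \<in> infinite_minimal_subshifts" "Y' \<subseteq> coded p"
    using exists_infinite_minimal_coded[OF p(1)] by blast
  then have "Y' \<noteq> {}" by (auto simp: infinite_minimal_subshifts_def)
  then have "lang n Y' = lang n Y" using lang_coded[OF p(1) Y'(2) _ p(3)] p(4) by simp
  then show ?thesis using p(2) Y' coded_by_iff[OF p(1)] by blast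
qed

lemma stages_refine:
  assumes s: "staged Y (Suc (Suc k))"
  shows "pair_refines (the (stage Y (Suc k))) (the (stage Y (Suc (Suc k))))"
proof -
  obtain p where "stage Y (Suc (Suc k)) = Some p" "extends (stage Y (Suc k)) p"
    using s by (rule stage_SucE)
  moreover obtain q where "stage Y (Suc k) = Some q"
    using s staged_Suc by (metis stage.simps(2))
  ultimately show ?thesis by (simp add: extends_def del: stage.simps)
qed

lemma stage_one_good: "staged Y (Suc 0) \<Longrightarrow> good (the (stage Y (Suc 0)))"
  using stage_good[of Y "Suc 0"] by simp

lemma all_stages_chain_limit:
  assumes Y: "Y \<in> infinite_minimal_subshifts" and s: "\<And>k. staged Y k"
  shows "\<exists>P. refining_chain P \<and> (\<forall>k. Y \<subseteq> coded (P k)) \<and> Y = chain_limit P"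
proof -
  define P where "P k = the (stage Y (Suc k))" for k
  have chain: "refining_chain P"
    unfolding refining_chain_def P_def using stage_one_good stages_refine s by blast
  moreover have sub: "Y \<subseteq> coded (P k)" for k
    using stage_good[OF s, of "Suc k"] by (simp add: P_def)
  moreover have "subshift Y" "Y \<noteq> {}" using Y by (auto simp: infinite_minimal_subshifts_def)
  ultimately show ?thesis using minimal_eq_chain_limit by blast
qed

text \<open>Fusion: choose \<open>Y 0, Y 1, \<dots>\<close> such that \<open>Y k\<close> admits \<open>k\<close> selections and each \<open>Y (k + 1)\<close>
  has the same words of length \<open>n k\<close> as \<open>Y k\<close>, where \<open>n k\<close> protects the selections made so far.
  The selected pairs form a chain.  Its limit has the same words of length \<open>n k\<close> as \<open>Y k\<close>,
  because both it and all later \<open>Y j\<close> are coded by pairs longer than \<open>n k\<close>; so it admits all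
  selections.\<close>
lemma all_stages_dense:
  assumes Y0: "Y0 \<in> infinite_minimal_subshifts"
  shows "\<exists>Z\<in>infinite_minimal_subshifts. (\<forall>k. staged Z k) \<and> lang n0 Z = lang n0 Y0"
proof -
  define I where "I k s \<longleftrightarrow> fst s \<in> infinite_minimal_subshifts \<and> staged (fst s) k
     \<and> (\<forall>Z. lang (snd s) Z = lang (snd s) (fst s) \<longrightarrow> staged Z k \<and> (\<forall>j\<le>k. stage Z j = stage (fst s) j))
     \<and> n0 \<le> snd s \<and> lang n0 (fst s) = lang n0 Y0" for k and s :: "(int \<Rightarrow> int) set \<times> nat"
  define Q where "Q s s' \<longleftrightarrow> snd s \<le> snd s' \<and> lang (snd s) (fst s') = lang (snd s) (fst s)"
    for s s' :: "(int \<Rightarrow> int) set \<times> nat"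
  have "\<exists>f. \<forall>k. I k (f k) \<and> Q (f k) (f (Suc k))"
  proof (rule dependent_nat_choice)
    show "\<exists>s. I 0 s" using Y0 by (intro exI[of _ "(Y0, n0)"]) (simp add: I_def staged_def)
  next
    fix s k assume I: "I k s"
    obtain Y n where s: "s = (Y, n)" by (cases s)
    have Y: "Y \<in> infinite_minimal_subshifts" "staged Y k"
      "\<And>Y'. lang n Y' = lang n Y \<Longrightarrow> staged Y' k \<and> (\<forall>j\<le>k. stage Y' j = stage Y j)"
      "n0 \<le> n" "lang n0 Y = lang n0 Y0" using I unfolding I_def s fst_conv snd_conv by blast+
    obtain p Y' where Y': "Y' \<in> infinite_minimal_subshifts" "lang n Y' = lang n Y"
      "extends (stage Y k) p" "coded_by p Y'" using staged_step_dense[OF Y(1,2)] by blast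
    have st: "staged Y' (Suc k)"
      using Y(3)[OF Y'(2)] Y'(3,4) unfolding staged_Suc by (metis order_refl)
    then obtain m where m: "\<And>Z. lang m Z = lang m Y' \<Longrightarrow>
        staged Z (Suc k) \<and> (\<forall>j\<le>Suc k. stage Z j = stage Y' j)"
      using stage_locally_constant by blast
    have "staged Z (Suc k) \<and> (\<forall>j\<le>Suc k. stage Z j = stage Y' j)"
      if "lang (max m n) Z = lang (max m n) Y'" for Z
      by (rule m, rule lang_eq_mono[OF that]) simp
    moreover have "n0 \<le> max m n" using Y(4) by simp
    moreover have "lang n0 Y' = lang n0 Y0" using lang_eq_mono[OF Y'(2) Y(4)] Y(5) by (rule trans)
    ultimately have "I (Suc k) (Y', max m n)"
      using Y'(1) st unfolding I_def fst_conv snd_conv by blast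
    moreover have "Q s (Y', max m n)" using Y'(2) by (simp add: Q_def s)
    ultimately show "\<exists>s'. I (Suc k) s' \<and> Q s s'" by blast
  qed
  then obtain f where f: "\<And>k. I k (f k)" "\<And>k. Q (f k) (f (Suc k))" by blast
  define Y n where "Y k = fst (f k)" and "n k = snd (f k)" for k
  have Y: "Y k \<in> infinite_minimal_subshifts" "staged (Y k) k" "n0 \<le> n k" "lang n0 (Y k) = lang n0 Y0" for k
    using f(1)[of k] unfolding I_def Y_def n_def by blast+
  have const: "staged Z k \<and> (\<forall>j\<le>k. stage Z j = stage (Y k) j)" if "lang (n k) Z = lang (n k) (Y k)" for k Z
    using f(1)[of k] that unfolding I_def Y_def n_def by blast
  have close: "n k \<le> n j \<and> lang (n k) (Y j) = lang (n k) (Y k)" if "k \<le> j" for k j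
    using that
  proof (induction rule: dec_induct)
    case (step j)
    have "n j \<le> n (Suc j)" "lang (n j) (Y (Suc j)) = lang (n j) (Y j)"
      using f(2)[of j] unfolding Q_def Y_def n_def by blast+
    then show ?case using step.IH lang_eq_mono[of "n j" "Y (Suc j)" "Y j" "n k"] by (metis order.trans)
  qed simp
  define P where "P k = the (stage (Y (Suc k)) (Suc k))" for k
  have P: "P k = the (stage (Y j) (Suc k))" if "Suc k \<le> j" for k j
    using const[of "Suc k" "Y j"] close[OF that] by (simp add: P_def del: stage.simps)
  have chain: "refining_chain P"
    unfolding refining_chain_def
  proof (intro conjI allI)
    show "good (P 0)" using stage_one_good Y(2)[of "Suc 0"] by (simp add: P_def)
    fix k show "pair_refines (P k) (P (Suc k))"
      using stages_refine[OF Y(2)[of "Suc (Suc k)"]] P[of k "Suc (Suc k)"] P[of "Suc k" "Suc (Suc k)"]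
      by (simp del: stage.simps)
  qed
  let ?Z = "chain_limit P"
  have Z: "?Z \<in> infinite_minimal_subshifts" by (rule chain_limit_infinite_minimal[OF chain])
  have agree: "lang (n k) ?Z = lang (n k) (Y k)" for k
  proof -
    \<comment> \<open>late enough for \<open>Y (j + 1)\<close> to agree with \<open>Y k\<close>, and for \<open>P j\<close> to be longer than \<open>n k\<close>\<close>
    define j where "j = n k + k"
    have "Y (Suc j) \<subseteq> coded (P j)"
      using stage_good[OF Y(2)[of "Suc j"]] by (simp add: P_def)
    moreover have "?Z \<subseteq> coded (P j)" by (auto simp: chain_limit_def)
    moreover have "n k \<le> plen (P j)" using chain_plen[OF chain, of j] by (simp add: j_def)
    moreover have "Y (Suc j) \<noteq> {}" "?Z \<noteq> {}"
      using Y(1)[of "Suc j"] Z by (auto simp: infinite_minimal_subshifts_def)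
    ultimately have "lang (n k) ?Z = lang (n k) (Y (Suc j))"
      using lang_coded[OF chain_good[OF chain]] by metis
    also have "\<dots> = lang (n k) (Y k)" using close[of k "Suc j"] by (simp add: j_def)
    finally show ?thesis .
  qed
  have "staged ?Z k" for k using const[OF agree] by blast
  moreover have "lang n0 ?Z = lang n0 Y0"
    using lang_eq_mono[OF agree[of 0] Y(3)[of 0]] Y(4) by simp
  ultimately show ?thesis using Z by blast
qed

theorem theorem6p6:
  shows "generic_in infinite_minimal_topology
           {X \<in> infinite_minimal_subshifts.
              strong_Toeplitz 2 X \<and> \<not> conjugate X shift X (inv shift)}"
proof -
  define G where "G = (\<Inter>k. {Y \<in> infinite_minimal_subshifts. staged Y k})"
  have G: "Y \<in> G \<longleftrightarrow> Y \<in> infinite_minimal_subshifts \<and> (\<forall>k. staged Y k)" for Y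
    by (auto simp: G_def)
  have "openin infinite_minimal_topology {Y \<in> infinite_minimal_subshifts. staged Y k}" for k
    by (rule openin_infinite_minimalI) (use stage_locally_constant in blast)+
  then have gdelta: "gdelta_in infinite_minimal_topology G"
    unfolding G_def by (intro gdelta_in_Inter) (auto intro: open_imp_gdelta_in)
  have dense: "infinite_minimal_topology closure_of G = topspace infinite_minimal_topology"
  proof
    show "infinite_minimal_topology closure_of G \<subseteq> topspace infinite_minimal_topology"
      by (rule closure_of_subset_topspace)
    show "topspace infinite_minimal_topology \<subseteq> infinite_minimal_topology closure_of G"
      unfolding topspace_infinite_minimal_topology
    proof (intro subsetI closure_of_infinite_minimalI)
      fix Y n assume "Y \<in> infinite_minimal_subshifts"
      from all_stages_dense[OF this] show "\<exists>Z\<in>G. lang n Z = lang n Y" unfolding Bex_def G by blast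
    qed (auto simp: G)
  qed
  have "strong_Toeplitz 2 Y \<and> \<not> conjugate Y shift Y (inv shift)" if "Y \<in> G" for Y
  proof -
    have Y: "Y \<in> infinite_minimal_subshifts" "staged Y k" for k using that unfolding G by blast+
    obtain P where P: "refining_chain P" "\<And>k. Y \<subseteq> coded (P k)" "Y = chain_limit P"
      using all_stages_chain_limit[OF Y] by blast
    have sub: "subshift Y" "Y \<noteq> {}" using Y(1) by (auto simp: infinite_minimal_subshifts_def)
    have "strong_Toeplitz 2 Y" unfolding P(3) by (rule strong_Toeplitz_chain_limit[OF P(1)])
    then show ?thesis using not_conjugate_inverse[OF P(1) sub P(2)] by blast
  qed
  then have good: "G \<subseteq> {X \<in> infinite_minimal_subshifts. strong_Toeplitz 2 X \<and> \<not> conjugate X shift X (inv shift)}"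
    unfolding subset_iff mem_Collect_eq using G by blast
  have "{X \<in> infinite_minimal_subshifts. strong_Toeplitz 2 X \<and> \<not> conjugate X shift X (inv shift)}
      \<subseteq> topspace infinite_minimal_topology"
    unfolding topspace_infinite_minimal_topology by blast
  then show ?thesis
    unfolding generic_in_def by (intro conjI exI[of _ G] gdelta dense good)
qed

end
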